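(* $\mathrm{LPO}^\dagger\equiv_{\mathrm{W}}\lim^\dagger\equiv_{\mathrm{W}}\mathrm{UC}_{\mathbb{N}^\mathbb{N}}$.
   Context: Weihrauch reducibility: for partial multivalued $f,g$ on Baire space (or on represented spaces, via realizers), $f\leq_{\mathrm{W}}g$ iff there are computable $K,H:\subseteq\mathbb{N}^\mathbb{N}\to\mathbb{N}^\mathbb{N}$ such that $p\mapsto K\langle p,G(H(p))\rangle$ realizes $f$ for every realizer $G$ of $g$; $\equiv_{\mathrm{W}}$ is the induced equivalence. Here $\langle\cdot,\cdot\rangle$, $\langle p_0,p_1,\ldots\rangle$ are standard computable tuplings on $\mathbb{N}^\mathbb{N}$. $\mathrm{LPO}:\{0,1\}^\mathbb{N}\to\{0,1\}$ maps $0^\mathbb{N}$ to $1$ and every other $p$ to $0$. $\lim:\subseteq\mathbb{N}^\mathbb{N}\to\mathbb{N}^\mathbb{N}$ is $\lim(p)(n)=\lim_{i\to\infty}p(\langle n,i\rangle)$, defined when all these limits exist. $\mathcal{A}(\mathbb{N}^\mathbb{N})$ is the space of closed subsets of Baire space, a name of $A$ being an enumeration of finite words whose cylinders cover exactly $\mathbb{N}^\mathbb{N}\setminus A$; $\mathrm{UC}_{\mathbb{N}^\mathbb{N}}:\subseteq\mathcal{A}(\mathbb{N}^\mathbb{N})\to\mathbb{N}^\mathbb{N}$ maps a singleton $\{x\}$ to $x$. Any $f$ between represented spaces is regarded as the map $\delta_Y\circ f\circ\delta_X^{-1}$ on Baire space. Fix a standard enumeration $(\Phi_n)_{n\in\mathbb{N}}$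 of the partial computable functions $\Phi_n:\subseteq\mathbb{N}^\mathbb{N}\to\mathbb{N}^\mathbb{N}$. For partial multivalued $f:\subseteq\mathbb{N}^\mathbb{N}\rightrightarrows\mathbb{N}^\mathbb{N}$, define $f^\dagger:\subseteq\mathbb{N}^\mathbb{N}\rightrightarrows\mathbb{N}^\mathbb{N}$ recursively: (1) $f^\dagger(\langle 0p,q\rangle)=q$; (2) $r\in f^\dagger(\langle 1p,nq\rangle)$ iff there is $h\in f^\dagger(\langle p,q\rangle)$ and $s\in f(\Phi_n(h))$ with $r=\langle s,h\rangle$ (here $nq$ is the sequence with first entry $n$ followed by $q$); (3) $f^\dagger(\langle 2\langle p_0,p_1,\ldots\rangle,\langle q_0,q_1,\ldots\rangle\rangle)=\{\langle r_0,r_1,\ldots\rangle\mid r_i\in f^\dagger(\langle p_i,q_i\rangle)\}$. Its domain is the set of inputs on which these clauses yield a value; in particular the first component of any input in the domain is a name in $\mathrm{dom}(\delta_{\mathrm{nK}})$, where $\delta_{\mathrm{nK}}(0p)=0$, $\delta_{\mathrm{nK}}(1p)=\delta_{\mathrm{nK}}(p)+1$, $\delta_{\mathrm{nK}}(2\langle p_0,p_1,\ldots\rangle)=\sup_i\delta_{\mathrm{nK}}(p_i)$. *)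

theory Defs
  imports Complex_Main "HOL-Library.Nat_Bijection"
begin

type_synonym baire = "nat \<Rightarrow> nat"

text \<open>
  Partial computable functions on Baire space are given by programs for partial recursive
  functions relative to an oracle \<open>p\<close>. Programs denote unary partial functions on the naturals,
  several arguments being coded by \<^const>\<open>prod_encode\<close>; \<^const>\<open>None\<close> means divergence.
\<close>

datatype prog =
    Zero | Succ | Left | Right | Oracle
  | Pair prog prog | Comp prog prog | Prec prog prog | Mu prog

primrec run :: "prog \<Rightarrow> baire \<Rightarrow> nat \<Rightarrow> nat option" where
  "run Zero p x = Some 0"
| "run Succ p x = Some (Suc x)"
| "run Left p x = Some (fst (prod_decode x))"
| "run Right p x = Some (snd (prod_decode x))"
| "run Oracle p x = Some (p x)"
| "run (Pair c d) p x =
     Option.bind (run c p x) (\<lambda>a. Option.bind (run d p x) (\<lambda>b. Some (prod_encode (a, b))))"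
| "run (Comp c d) p x = Option.bind (run d p x) (run c p)"
| "run (Prec c d) p x =
     (let (a, n) = prod_decode x in
      rec_nat (run c p a)
        (\<lambda>m r. Option.bind r (\<lambda>y. run d p (prod_encode (a, prod_encode (m, y))))) n)"
| "run (Mu c) p x =
     (let halts_at = (\<lambda>n. run c p (prod_encode (x, n)) = Some 0 \<and>
                          (\<forall>m<n. run c p (prod_encode (x, m)) \<noteq> None))
      in if \<exists>n. halts_at n then Some (LEAST n. halts_at n) else None)"

text \<open>An explicit Goedel numbering; it is bijective, so every number is the index of a program.\<close>

primrec index :: "prog \<Rightarrow> nat" where
  "index Zero = 0"
| "index Succ = 1"
| "index Left = 2"
| "index Right = 3"
| "index Oracle = 4"
| "index (Pair c d) = 5 + 4 * prod_encode (index c, index d)"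
| "index (Comp c d) = 6 + 4 * prod_encode (index c, index d)"
| "index (Prec c d) = 7 + 4 * prod_encode (index c, index d)"
| "index (Mu c) = 8 + 4 * index c"

lemma inj_index: "inj index"
proof (rule injI)
  fix c d show "index c = index d \<Longrightarrow> c = d"
  proof (induction c arbitrary: d)
    case (Pair c1 c2) then show ?case by (cases d) (auto, presburger+)
  next
    case (Comp c1 c2) then show ?case by (cases d) (auto, presburger+)
  next
    case (Prec c1 c2) then show ?case by (cases d) (auto, presburger+)
  next
    case (Mu c) then show ?case by (cases d) (auto, presburger+)
  qed (case_tac d; simp)+
qed

lemma surj_index: "surj index"
proof -
  have "\<exists>c. index c = n" for n
  proof (induction n rule: less_induct)
    case (less n)
    show ?case
    proof (cases "n < 5")
      case True
      then have "n = 0 \<or> n = 1 \<or> n = 2 \<or> n = 3 \<or> n = 4" by auto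
      then show ?thesis
        using index.simps(1-5) by metis
    next
      case False
      define m where "m = (n - 5) div 4"
      obtain a b where ab: "m = prod_encode (a, b)"
        by (metis prod_decode_inverse surj_pair)
      have "m < n" using False by (auto simp: m_def)
      moreover have "a \<le> m" "b \<le> m"
        using ab le_prod_encode_1 le_prod_encode_2 by auto
      ultimately obtain ca cb cm where c: "index ca = a" "index cb = b" "index cm = m"
        by (meson less le_less_trans)
      have "n = 5 + 4 * m \<or> n = 6 + 4 * m \<or> n = 7 + 4 * m \<or> n = 8 + 4 * m"
        using False unfolding m_def by presburger
      then show ?thesis
        using c ab index.simps(6-9) by metis
    qed
  qed
  then show ?thesis by (metis surjI)
qed

lemma bij_index: "bij index"
  by (simp add: bij_def inj_index surj_index)

definition Phi :: "nat \<Rightarrow> baire \<rightharpoonup> baire" where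
  "Phi n p =
     (let c = inv index n in
      if \<forall>k. run c p k \<noteq> None then Some (\<lambda>k. the (run c p k)) else None)"

text \<open>As usual, a program for a partial function may also converge outside its domain.\<close>

definition computable :: "(baire \<rightharpoonup> baire) \<Rightarrow> bool" where
  "computable F \<longleftrightarrow> (\<exists>n. F \<subseteq>\<^sub>m Phi n)"

definition scons :: "nat \<Rightarrow> baire \<Rightarrow> baire"  (infixr \<open>##\<close> 65) where
  "n ## p = case_nat n p"

definition pair :: "baire \<Rightarrow> baire \<Rightarrow> baire" where
  "pair p q = (\<lambda>n. if even n then p (n div 2) else q (n div 2))"

definition tuple :: "(nat \<Rightarrow> baire) \<Rightarrow> baire" where
  "tuple p = (\<lambda>n. case prod_decode n of (i, k) \<Rightarrow> p i k)"

text \<open>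
  A partial multivalued function is a set-valued function; its domain consists of the
  arguments with nonempty value.
\<close>

definition realizer :: "(baire \<rightharpoonup> baire) \<Rightarrow> (baire \<Rightarrow> baire set) \<Rightarrow> bool" where
  "realizer F f \<longleftrightarrow> (\<forall>p. f p \<noteq> {} \<longrightarrow> (\<exists>q\<in>f p. F p = Some q))"

definition weihrauch_le :: "(baire \<Rightarrow> baire set) \<Rightarrow> (baire \<Rightarrow> baire set) \<Rightarrow> bool"
    (infix \<open>\<le>\<^sub>W\<close> 50) where
  "f \<le>\<^sub>W g \<longleftrightarrow>
     (\<exists>K H. computable K \<and> computable H \<and>
        (\<forall>G. realizer G g \<longrightarrow>
           realizer (\<lambda>p. Option.bind (H p) (\<lambda>h. Option.bind (G h) (\<lambda>r. K (pair p r)))) f))"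

definition weihrauch_eq :: "(baire \<Rightarrow> baire set) \<Rightarrow> (baire \<Rightarrow> baire set) \<Rightarrow> bool"
    (infix \<open>\<equiv>\<^sub>W\<close> 50) where
  "f \<equiv>\<^sub>W g \<longleftrightarrow> f \<le>\<^sub>W g \<and> g \<le>\<^sub>W f"

text \<open>
  A representation of a space is a partial map from Baire space to it. The following turns a
  multivalued map between represented spaces into the corresponding one on names.
\<close>

definition on_names ::
    "(baire \<rightharpoonup> 'a) \<Rightarrow> (baire \<rightharpoonup> 'b) \<Rightarrow> ('a \<Rightarrow> 'b set) \<Rightarrow> baire \<Rightarrow> baire set" where
  "on_names \<delta>X \<delta>Y f p = {q. \<exists>x y. \<delta>X p = Some x \<and> \<delta>Y q = Some y \<and> y \<in> f x}"

text \<open>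
  The number \<open>n\<close> has the unique name \<open>0\<dots>010\<dots>\<close> with \<open>n\<close> leading zeros. Uniqueness of names
  matters: \<open>LPO\<close> has to be single-valued on names, since otherwise its iteration below could
  select a name on which a later program happens to converge.
\<close>

definition delta_nat :: "baire \<rightharpoonup> nat" where
  "delta_nat q =
     (if \<exists>n. q = (\<lambda>k. of_bool (k = n)) then Some (THE n. q = (\<lambda>k. of_bool (k = n))) else None)"

definition cylinder :: "nat list \<Rightarrow> baire set" where
  "cylinder w = {x. \<forall>i<length w. x i = w ! i}"

text \<open>
  The entry \<open>0\<close> enumerates no word, so that the whole space has a name too. The sets having a
  name are exactly the closed ones.
\<close>

definition delta_closed :: "baire \<rightharpoonup> baire set" where
  "delta_closed p = Some (- (\<Union>w \<in> {w. \<exists>n. p n = Suc (list_encode w)}. cylinder w))"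

definition LPO_map :: "baire \<Rightarrow> nat set" where
  "LPO_map p = (if range p \<subseteq> {0, 1} then {if p = (\<lambda>_. 0) then 1 else 0} else {})"

definition LPO :: "baire \<Rightarrow> baire set" where
  "LPO = on_names Some delta_nat LPO_map"

definition Lim_Baire :: "baire \<Rightarrow> baire set" where
  "Lim_Baire p = {q. \<forall>n. (\<lambda>i. p (prod_encode (n, i))) \<longlonglongrightarrow> q n}"

definition UC_map :: "baire set \<Rightarrow> baire set" where
  "UC_map A = {x. A = {x}}"

definition UC_Baire :: "baire \<Rightarrow> baire set" where
  "UC_Baire = on_names delta_closed Some UC_map"

inductive dagger_rel :: "(baire \<Rightarrow> baire set) \<Rightarrow> baire \<Rightarrow> baire \<Rightarrow> bool" for f where
  zero: "dagger_rel f (pair (0 ## p) q) q"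
| succ: "dagger_rel f (pair p q) h \<Longrightarrow> Phi n h = Some z \<Longrightarrow> s \<in> f z \<Longrightarrow>
           dagger_rel f (pair (1 ## p) (n ## q)) (pair s h)"
| sup: "(\<And>i. dagger_rel f (pair (p i) (q i)) (r i)) \<Longrightarrow>
           dagger_rel f (pair (2 ## tuple p) (tuple q)) (tuple r)"

definition dagger :: "(baire \<Rightarrow> baire set) \<Rightarrow> baire \<Rightarrow> baire set"
    (\<open>_\<^sup>\<dagger>\<close> [1000] 1000) where
  "f\<^sup>\<dagger> x = {r. dagger_rel f x r}"

end

theory Submission
  imports Defs
begin

text \<open>
  Both directions are uniform in the iterated map \<open>f\<close>, so that \<open>LPO\<close> and \<open>lim\<close> are only compared
  through unique choice.

  To reduce \<open>f\<^sup>\<dagger>\<close> to unique choice, let \<open>y\<close> record everything that happens at all nodes of the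
  well-founded name: the inputs and results there, the complete graph of all programs relative to
  the result, and a witness that \<open>f\<close> has been applied correctly. All of this is characterised by local
  conditions, so the records form a closed set, and well-foundedness leaves exactly one record.

  Conversely, let \<open>x\<close> be the only point of a closed set. Whether \<open>x\<close> extends a word \<open>w\<close> is the question
  who wins a game in which one player builds a point of the closed set inside the cylinder of \<open>w\<close> and the
  other one builds a point outside it. As there are no two points, the game tree is well-founded; it
  is decidable in the name of the set, so it can be turned into a name for \<open>f\<^sup>\<dagger>\<close>, with one application
  of \<open>f\<close> per position deciding whether some move leads to a lost position.
\<close>

section \<open>Total recursive functionals\<close>

text \<open>Unique choice accepts only singletons, so in the first reduction every auxiliary datum
  must be determined, not merely exist. Hence divergence is recorded as a value, witnesses are least
  ones, and entries carrying no information are pinned to 0. Divergence is the critical point: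
  finite information can confirm that a program converges, but not that it diverges. Yet a table
  that commits itself to an answer for all programs at once is refuted locally wherever it is wrong.
  In the second reduction the obstacle is well-foundedness. The words not yet excluded by a name of
  \<open>{x}\<close> form a tree with the infinite path \<open>x\<close>, so that tree itself gives
  no name for the iteration. Playing two candidate points on different sides of a cylinder against
  each other removes the path: only one side can follow \<open>x\<close>, and the other is refuted
  after finitely many moves.\<close>

abbreviation enc :: "nat \<Rightarrow> nat \<Rightarrow> nat" where "enc a b \<equiv> prod_encode (a, b)"

definition lft :: "nat \<Rightarrow> nat" where "lft z = fst (prod_decode z)"
definition rgt :: "nat \<Rightarrow> nat" where "rgt z = snd (prod_decode z)"

lemma lft_enc [simp]: "lft (enc a b) = a" and rgt_enc [simp]: "rgt (enc a b) = b"
  by (simp_all add: lft_def rgt_def)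

lemma enc_lft_rgt [simp]: "enc (lft z) (rgt z) = z"
  by (simp add: lft_def rgt_def)

lemma prod_decode_lft_rgt: "prod_decode z = (lft z, rgt z)"
  by (simp add: lft_def rgt_def)

lemma rgt_le: "rgt z \<le> z"
  by (metis enc_lft_rgt le_prod_encode_2)

text \<open>Totality for every oracle keeps composition free of definedness conditions. The one
  algorithm that needs unbounded search is written out as a program in
  \<open>search_program\<close>.\<close>

definition recfun :: "(baire \<Rightarrow> nat \<Rightarrow> nat) \<Rightarrow> bool" where
  "recfun f \<longleftrightarrow> (\<exists>c. \<forall>p x. run c p x = Some (f p x))"

named_theorems rec_intros

lemma recfunI: "(\<And>p x. run c p x = Some (f p x)) \<Longrightarrow> recfun f"
  by (auto simp: recfun_def)

lemma recfunE:
  assumes "recfun f" obtains c where "\<And>p x. run c p x = Some (f p x)"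
  using assms by (auto simp: recfun_def)

lemma recfun_id [rec_intros]: "recfun (\<lambda>p x. x)"
  by (rule recfunI[of "Pair Left Right"]) simp

lemma recfun_compose:
  assumes "recfun f" "recfun g" shows "recfun (\<lambda>p x. f p (g p x))"
proof -
  obtain c d where "\<And>p x. run c p x = Some (f p x)" "\<And>p x. run d p x = Some (g p x)"
    using assms by (auto elim!: recfunE)
  then show ?thesis by (intro recfunI[of "Comp c d"]) simp
qed

lemma recfun_Suc [rec_intros]: "recfun f \<Longrightarrow> recfun (\<lambda>p x. Suc (f p x))"
  using recfun_compose[of "\<lambda>_. Suc"] recfunI[of Succ] by simp

lemma recfun_lft [rec_intros]: "recfun f \<Longrightarrow> recfun (\<lambda>p x. lft (f p x))"
  using recfun_compose[of "\<lambda>_. lft"] recfunI[of Left] by (simp add: lft_def)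

lemma recfun_rgt [rec_intros]: "recfun f \<Longrightarrow> recfun (\<lambda>p x. rgt (f p x))"
  using recfun_compose[of "\<lambda>_. rgt"] recfunI[of Right] by (simp add: rgt_def)

lemma recfun_oracle [rec_intros]: "recfun f \<Longrightarrow> recfun (\<lambda>p x. p (f p x))"
  using recfun_compose[of "\<lambda>p. p"] recfunI[of Oracle] by simp

lemma recfun_const [rec_intros]: "recfun (\<lambda>p x. n)"
proof (induction n)
  case 0 show ?case by (rule recfunI[of Zero]) simp
next
  case (Suc n) then show ?case by (rule recfun_Suc)
qed

lemma recfun_enc [rec_intros]:
  assumes "recfun f" "recfun g" shows "recfun (\<lambda>p x. enc (f p x) (g p x))"
proof -
  obtain c d where "\<And>p x. run c p x = Some (f p x)" "\<And>p x. run d p x = Some (g p x)"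
    using assms by (auto elim!: recfunE)
  then show ?thesis by (intro recfunI[of "Pair c d"]) simp
qed

lemma recfun_compose2:
  assumes "recfun (\<lambda>p z. F p (lft z) (rgt z))" "recfun f" "recfun g"
  shows "recfun (\<lambda>p x. F p (f p x) (g p x))"
  using recfun_compose[OF assms(1) recfun_enc[OF assms(2,3)]] by simp

lemma recfun_rec_nat [rec_intros]:
  assumes "recfun g" "recfun (\<lambda>p z. s p (lft z) (lft (rgt z)) (rgt (rgt z)))" "recfun n"
  shows "recfun (\<lambda>p x. rec_nat (g p x) (\<lambda>m y. s p x m y) (n p x))"
proof -
  obtain c d where c: "\<And>p x. run c p x = Some (g p x)"
    and d: "\<And>p z. run d p z = Some (s p (lft z) (lft (rgt z)) (rgt (rgt z)))"
    using assms by (auto elim!: recfunE)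
  have "rec_nat (Some a) (\<lambda>m r. Option.bind r (\<lambda>y. Some (h m y))) k = Some (rec_nat a h k)"
    for a :: nat and h k by (induction k) auto
  then have "recfun (\<lambda>p z. rec_nat (g p (lft z)) (\<lambda>m y. s p (lft z) m y) (rgt z))"
    by (intro recfunI[of "Prec c d"]) (simp add: c d prod_decode_lft_rgt)
  from recfun_compose2[OF this recfun_id assms(3)] show ?thesis .
qed

lemma recfun_pred [rec_intros]:
  assumes "recfun f" shows "recfun (\<lambda>p x. f p x - Suc 0)"
proof -
  have "recfun (\<lambda>p x. rec_nat 0 (\<lambda>m y. m) (f p x))"
    by (intro rec_intros assms)
  moreover have "rec_nat 0 (\<lambda>m y. m) k = k - Suc 0" for k by (cases k) auto
  ultimately show ?thesis by simp
qed

lemma recfun_minus [rec_intros]: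
  assumes "recfun f" "recfun g" shows "recfun (\<lambda>p x. f p x - g p x)"
proof -
  have "recfun (\<lambda>p x. rec_nat (f p x) (\<lambda>m y. y - Suc 0) (g p x))"
    by (intro rec_intros assms)
  moreover have "rec_nat a (\<lambda>m y. y - Suc 0) k = a - k" for a k by (induction k) auto
  ultimately show ?thesis by simp
qed

lemma recfun_plus [rec_intros]:
  assumes "recfun f" "recfun g" shows "recfun (\<lambda>p x. f p x + g p x)"
proof -
  have "recfun (\<lambda>p x. rec_nat (f p x) (\<lambda>m y. Suc y) (g p x))"
    by (intro rec_intros assms)
  moreover have "rec_nat a (\<lambda>m y. Suc y) k = a + k" for a k by (induction k) auto
  ultimately show ?thesis by simp
qed

lemma recfun_times [rec_intros]:
  assumes "recfun f" "recfun g" shows "recfun (\<lambda>p x. f p x * g p x)"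
proof -
  have "recfun (\<lambda>p x. rec_nat 0 (\<lambda>m y. y + f p x) (g p x))"
    by (intro rec_intros recfun_compose[OF assms(1)] assms)
  moreover have "rec_nat 0 (\<lambda>m y. y + a) k = a * k" for a k by (induction k) auto
  ultimately show ?thesis by simp
qed

lemma recfun_If [rec_intros]:
  assumes "recfun (\<lambda>p x. of_bool (P p x))" "recfun f" "recfun g"
  shows "recfun (\<lambda>p x. if P p x then f p x else g p x)"
proof -
  have "recfun (\<lambda>p x. rec_nat (g p x) (\<lambda>m y. f p x) (of_bool (P p x)))"
    by (intro rec_intros recfun_compose[OF assms(2)] assms)
  moreover have "rec_nat a (\<lambda>m y. b) (of_bool Q) = (if Q then b else a)" for a b :: nat and Q
    by auto
  ultimately show ?thesis by simp
qed

lemma recfun_not [rec_intros]: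
  assumes "recfun (\<lambda>p x. of_bool (P p x))" shows "recfun (\<lambda>p x. of_bool (\<not> P p x))"
proof -
  have "recfun (\<lambda>p x. Suc 0 - of_bool (P p x))" by (intro rec_intros assms)
  moreover have "Suc 0 - of_bool Q = of_bool (\<not> Q)" for Q by simp
  ultimately show ?thesis by simp
qed

lemma recfun_conj [rec_intros]:
  assumes "recfun (\<lambda>p x. of_bool (P p x))" "recfun (\<lambda>p x. of_bool (Q p x))"
  shows "recfun (\<lambda>p x. of_bool (P p x \<and> Q p x))"
  using recfun_times[OF assms] by (simp add: of_bool_conj)

lemma recfun_imp [rec_intros]:
  assumes "recfun (\<lambda>p x. of_bool (P p x))" "recfun (\<lambda>p x. of_bool (Q p x))"
  shows "recfun (\<lambda>p x. of_bool (P p x \<longrightarrow> Q p x))"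
proof -
  have "recfun (\<lambda>p x. of_bool (\<not> (P p x \<and> \<not> Q p x)))" by (intro rec_intros assms)
  then show ?thesis by simp
qed

lemma recfun_le [rec_intros]:
  assumes "recfun f" "recfun g" shows "recfun (\<lambda>p x. of_bool (f p x \<le> g p x))"
proof -
  have "recfun (\<lambda>p x. Suc 0 - (f p x - g p x))" by (intro rec_intros assms)
  moreover have "Suc 0 - (a - b) = of_bool (a \<le> b)" for a b :: nat by auto
  ultimately show ?thesis by simp
qed

lemma recfun_less [rec_intros]:
  assumes "recfun f" "recfun g" shows "recfun (\<lambda>p x. of_bool (f p x < g p x))"
  using recfun_le[OF recfun_Suc[OF assms(1)] assms(2)] by (simp add: Suc_le_eq)

lemma recfun_eq [rec_intros]:
  assumes "recfun f" "recfun g" shows "recfun (\<lambda>p x. of_bool (f p x = g p x))"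
proof -
  have "recfun (\<lambda>p x. of_bool (f p x \<le> g p x \<and> g p x \<le> f p x))" by (intro rec_intros assms)
  then show ?thesis by (simp add: eq_iff)
qed

lemma recfun_iff [rec_intros]:
  assumes "recfun (\<lambda>p x. of_bool (P p x))" "recfun (\<lambda>p x. of_bool (Q p x))"
  shows "recfun (\<lambda>p x. of_bool (P p x \<longleftrightarrow> Q p x))"
proof -
  have "recfun (\<lambda>p x. of_bool ((P p x \<longrightarrow> Q p x) \<and> (Q p x \<longrightarrow> P p x)))"
    by (intro rec_intros assms)
  moreover have "(P p x \<longleftrightarrow> Q p x) \<longleftrightarrow> (P p x \<longrightarrow> Q p x) \<and> (Q p x \<longrightarrow> P p x)" for p x by blast
  ultimately show ?thesis by (simp only:)
qed

lemma recfun_ball [rec_intros]: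
  assumes "recfun n" "recfun (\<lambda>p z. of_bool (P p (lft z) (rgt z)))"
  shows "recfun (\<lambda>p x. of_bool (\<forall>m<n p x. P p x m))"
proof -
  have "recfun (\<lambda>p z. of_bool (P p (lft z) (lft (rgt z))))"
    by (rule recfun_compose2[OF assms(2)]) (intro rec_intros)+
  then have "recfun (\<lambda>p x. rec_nat (Suc 0) (\<lambda>m y. if P p x m then y else 0) (n p x))"
    by (intro rec_intros assms)
  moreover have "rec_nat (Suc 0) (\<lambda>m y. if Q m then y else 0) k = of_bool (\<forall>m<k. Q m)" for Q k
    by (induction k) (auto simp: less_Suc_eq)
  ultimately show ?thesis by simp
qed

lemma recfun_bex [rec_intros]:
  assumes "recfun n" "recfun (\<lambda>p z. of_bool (P p (lft z) (rgt z)))"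
  shows "recfun (\<lambda>p x. of_bool (\<exists>m<n p x. P p x m))"
proof -
  have "recfun (\<lambda>p x. of_bool (\<not> (\<forall>m<n p x. \<not> P p x m)))"
    by (intro rec_intros assms)
  then show ?thesis by simp
qed

lemma recfun_even [rec_intros]:
  assumes "recfun f" shows "recfun (\<lambda>p x. of_bool (even (f p x)))"
proof -
  have "recfun (\<lambda>p x. rec_nat (Suc 0) (\<lambda>m y. Suc 0 - y) (f p x))" by (intro rec_intros assms)
  moreover have "rec_nat (Suc 0) (\<lambda>m y. Suc 0 - y) k = of_bool (even k)" for k
    by (induction k) auto
  ultimately show ?thesis by simp
qed

lemma recfun_half [rec_intros]:
  assumes "recfun f" shows "recfun (\<lambda>p x. f p x div 2)"
proof -
  have "recfun (\<lambda>p x. rec_nat 0 (\<lambda>m y. if even m then y else Suc y) (f p x))"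
    by (intro rec_intros assms)
  moreover have "rec_nat 0 (\<lambda>m y. if even m then y else Suc y) k = k div 2" for k
    by (induction k) auto
  ultimately show ?thesis by simp
qed

lemma recfun_funpow:
  assumes "recfun (\<lambda>p z. s p z)" "recfun f" "recfun n"
  shows "recfun (\<lambda>p x. (s p ^^ n p x) (f p x))"
proof -
  have "recfun (\<lambda>p x. rec_nat (f p x) (\<lambda>m y. s p y) (n p x))"
    by (intro rec_intros recfun_compose[OF assms(1)] assms)
  moreover have "rec_nat a (\<lambda>m y. h y) k = (h ^^ k) a" for a and h :: "nat \<Rightarrow> nat" and k
    by (induction k) auto
  ultimately show ?thesis by simp
qed

text \<open>The step may also change \<open>lft z\<close>, so this is not primitive recursion on
  \<open>rgt z\<close>. But \<open>rgt z\<close> drops at each step and so bounds their number;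
  iterating a step that idles once \<open>P\<close> holds reaches the exit.\<close>

lemma recfun_tail_recursion:
  assumes "recfun (\<lambda>p z. of_bool (P p z))" "recfun out" "recfun step"
    and step: "\<And>p z. g p z = (if P p z then out p z else g p (step p z))"
    and dec: "\<And>p z. \<not> P p z \<Longrightarrow> rgt (step p z) < rgt z"
  shows "recfun g"
proof -
  define it where "it p z = (if P p z then z else step p z)" for p z
  have "g p z = out p ((it p ^^ Suc k) z)" if "rgt z \<le> k" for p z k
    using that
  proof (induction k arbitrary: z)
    case 0
    then show ?case using dec[of p z] step[of p z] by (auto simp: it_def)
  next
    case (Suc k)
    show ?case
    proof (cases "P p z")
      case True
      then have "(it p ^^ n) z = z" for n by (induction n) (auto simp: it_def)
      then show ?thesis using True step[of p z] by (simp only: if_True)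
    next
      case False
      have "g p z = g p (step p z)" using False step[of p z] by (simp only: if_False)
      also have "\<dots> = out p ((it p ^^ Suc k) (step p z))"
        using Suc dec[OF False] by (intro Suc.IH) linarith
      also have "step p z = it p z" using False by (simp add: it_def)
      finally show ?thesis by (simp only: funpow_Suc_right[of "Suc k"] o_apply)
    qed
  qed
  then have g: "g = (\<lambda>p z. out p ((it p ^^ Suc (rgt z)) z))" by (intro ext) blast
  have "recfun it" unfolding it_def by (intro rec_intros assms(1,3))
  then show ?thesis
    by (subst g) (rule recfun_compose[OF assms(2)], rule recfun_funpow, assumption, (rule rec_intros)+)
qed

section \<open>Decoding of finite words by recursive functions\<close>

definition code_tl :: "nat \<Rightarrow> nat" where "code_tl c = rgt (c - Suc 0)"
definition code_drop :: "nat \<Rightarrow> nat \<Rightarrow> nat" where "code_drop c n = (code_tl ^^ n) c"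
definition code_nth :: "nat \<Rightarrow> nat \<Rightarrow> nat" where "code_nth c n = lft (code_drop c n - Suc 0)"
text \<open>A code is at least as large as the length of its list, so it can serve as the loop
  bound.\<close>

definition code_len :: "nat \<Rightarrow> nat" where
  "code_len c = rec_nat 0 (\<lambda>m y. if code_drop c m = 0 then y else Suc y) c"

lemma code_drop_list_encode [simp]: "code_drop (list_encode w) n = list_encode (drop n w)"
proof (induction n)
  case (Suc n)
  have "code_tl (list_encode v) = list_encode (tl v)" for v
    \<comment> \<open>\<open>rgt_le\<close> at 0 gives \<open>rgt 0 = 0\<close>, so the code 0 of
      the empty list is its own tail.\<close>
    by (cases v) (use rgt_le[of 0] in \<open>auto simp: code_tl_def\<close>)
  with Suc show ?case by (simp add: code_drop_def drop_Suc tl_drop)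
qed (simp add: code_drop_def)

lemma code_nth_list_encode [simp]: "n < length w \<Longrightarrow> code_nth (list_encode w) n = w ! n"
  unfolding code_nth_def code_drop_list_encode
  by (subst Cons_nth_drop_Suc[symmetric]) auto

lemma list_encode_eq_0: "list_encode w = 0 \<longleftrightarrow> w = []"
  by (cases w) auto

lemma length_le_list_encode: "length w \<le> list_encode w"
  by (induction w) (auto intro: le_trans[OF _ le_prod_encode_2])

lemma code_len_list_encode [simp]: "code_len (list_encode w) = length w"
proof -
  have "rec_nat 0 (\<lambda>m y. if code_drop (list_encode w) m = 0 then y else Suc y) k = min k (length w)" for k
    by (induction k) (auto simp: list_encode_eq_0 min_def)
  then show ?thesis using length_le_list_encode[of w] by (simp add: code_len_def)
qed

lemma recfun_code_drop [rec_intros]: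
  "recfun f \<Longrightarrow> recfun g \<Longrightarrow> recfun (\<lambda>p x. code_drop (f p x) (g p x))"
  unfolding code_drop_def code_tl_def by (intro recfun_funpow[where s="\<lambda>p z. rgt (z - Suc 0)"] rec_intros)

lemma recfun_code_nth [rec_intros]:
  "recfun f \<Longrightarrow> recfun g \<Longrightarrow> recfun (\<lambda>p x. code_nth (f p x) (g p x))"
  unfolding code_nth_def by (intro rec_intros)


lemma recfun_code_len [rec_intros]:
  assumes "recfun f" shows "recfun (\<lambda>p x. code_len (f p x))"
proof -
  have "recfun (\<lambda>p x. code_len x)" unfolding code_len_def by (intro rec_intros)
  from recfun_compose[OF this assms] show ?thesis .
qed

lemma Phi_index: "(\<And>k. run c p k = Some (h k)) \<Longrightarrow> Phi (index c) p = Some h"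
  by (simp add: Phi_def inj_index)

lemma Phi_index_iff: "Phi (index c) p = Some h \<longleftrightarrow> (\<forall>k. run c p k = Some (h k))"
proof
  assume "Phi (index c) p = Some h"
  then have "\<forall>k. run c p k \<noteq> None" "h = (\<lambda>k. the (run c p k))"
    by (auto simp: Phi_def inj_index split: if_splits)
  then show "\<forall>k. run c p k = Some (h k)" by auto
qed (simp add: Phi_index)

lemma recfun_index:
  assumes "recfun f" obtains n where "\<And>p. Phi n p = Some (f p)"
  using assms by (metis recfunE Phi_index)

lemma computable_recfun: "recfun f \<Longrightarrow> computable (\<lambda>p. Some (f p))"
  by (metis computable_def map_le_def recfun_index)

section \<open>The iteration and reducibility\<close>

lemma scons_0 [simp]: "(n ## p) 0 = n" and scons_Suc [simp]: "(n ## p) (Suc k) = p k"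
  by (simp_all add: scons_def)

lemma scons_eta: "p 0 ## (\<lambda>k. p (Suc k)) = p"
  by (auto simp: scons_def fun_eq_iff split: nat.split)

lemma scons_inject [simp]: "n ## p = m ## q \<longleftrightarrow> n = m \<and> p = q"
  by (metis scons_0 scons_Suc ext)

lemma pair_even [simp]: "pair p q (2 * k) = p k" and pair_odd [simp]: "pair p q (Suc (2 * k)) = q k"
  by (simp_all add: pair_def)

lemma pair_0 [simp]: "pair p q 0 = p 0"
  by (simp add: pair_def)

lemma pair_inject [simp]: "pair p q = pair p' q' \<longleftrightarrow> p = p' \<and> q = q'"
  by (metis pair_even pair_odd ext)

lemma pair_eta: "pair (\<lambda>k. x (2 * k)) (\<lambda>k. x (Suc (2 * k))) = x"
  by (auto simp: pair_def fun_eq_iff)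

lemma tuple_enc [simp]: "tuple p (enc i k) = p i k"
  by (simp add: tuple_def)

lemma tuple_apply: "tuple p n = p (lft n) (rgt n)"
  by (simp add: tuple_def lft_def rgt_def case_prod_beta)

lemma tuple_inject [simp]: "tuple p = tuple q \<longleftrightarrow> p = q"
  by (metis tuple_enc ext)

lemma tuple_eta: "tuple (\<lambda>i k. x (enc i k)) = x"
  by (auto simp: tuple_apply)

text \<open>This and the next two lemmas are keyed on the first entry of the name and on shifted
  sequences, because nodes of a name are reached by shifting and not given in constructor
  form.\<close>

lemma dagger_rel_0:
  assumes "p 0 = 0" shows "dagger_rel f (pair p q) r \<longleftrightarrow> r = q"
proof
  assume "dagger_rel f (pair p q) r"
  then show "r = q" by (cases rule: dagger_rel.cases) (use assms in auto)
next
  assume "r = q"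
  then show "dagger_rel f (pair p q) r"
    using dagger_rel.zero[of f "\<lambda>k. p (Suc k)" q] assms scons_eta[of p] by simp
qed

lemma dagger_rel_1:
  assumes "p 0 = 1"
  shows "dagger_rel f (pair p q) r \<longleftrightarrow>
    (\<exists>h z s. dagger_rel f (pair (\<lambda>k. p (Suc k)) (\<lambda>k. q (Suc k))) h \<and> Phi (q 0) h = Some z \<and>
       s \<in> f z \<and> r = pair s h)" (is "_ \<longleftrightarrow> ?R")
proof
  assume "dagger_rel f (pair p q) r"
  then show ?R by (cases rule: dagger_rel.cases) (use assms in auto)
next
  assume ?R
  then show "dagger_rel f (pair p q) r"
    using dagger_rel.succ[of f "\<lambda>k. p (Suc k)" "\<lambda>k. q (Suc k)" _ "q 0"] assms
      scons_eta[of p] scons_eta[of q] by auto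
qed

lemma dagger_rel_2:
  assumes "p 0 = 2"
  shows "dagger_rel f (pair p q) r \<longleftrightarrow>
    (\<forall>i. dagger_rel f (pair (\<lambda>k. p (Suc (enc i k))) (\<lambda>k. q (enc i k))) (\<lambda>k. r (enc i k)))"
    (is "_ \<longleftrightarrow> ?R")
proof
  assume "dagger_rel f (pair p q) r"
  then show ?R by (cases rule: dagger_rel.cases) (use assms in auto)
next
  assume ?R
  then show "dagger_rel f (pair p q) r"
    using dagger_rel.sup[of f "\<lambda>i k. p (Suc (enc i k))" "\<lambda>i k. q (enc i k)" "\<lambda>i k. r (enc i k)"]
      assms scons_eta[of p] tuple_eta[of "\<lambda>k. p (Suc k)"] by (simp add: tuple_eta)
qed

lemma dagger_rel_le_2:
  assumes "dagger_rel f (pair p q) r" shows "p 0 = 0 \<or> p 0 = 1 \<or> p 0 = 2"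
  using assms by (cases rule: dagger_rel.cases) auto

text \<open>\<open>Phi n\<close> is a function, so \<open>f\<close> is the only source of choice in
  its iteration.\<close>

lemma dagger_rel_unique:
  assumes "\<And>z s t. s \<in> f z \<Longrightarrow> t \<in> f z \<Longrightarrow> s = t"
  shows "dagger_rel f x r \<Longrightarrow> dagger_rel f x t \<Longrightarrow> r = t"
proof (induction arbitrary: t rule: dagger_rel.induct)
  case (zero p q)
  then show ?case by (simp add: dagger_rel_0)
next
  case (succ p q h n z s)
  obtain h' z' s' where "dagger_rel f (pair p q) h'" "Phi n h' = Some z'" "s' \<in> f z'" "t = pair s' h'"
    using succ.prems by (auto simp: dagger_rel_1)
  with succ assms show ?case by (metis option.inject)
next
  case (sup p q r)
  then show ?case by (simp add: dagger_rel_2) (metis tuple_eta ext)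
qed

text \<open>Replacing the oracle by a program composes functionals on Baire space, whereas
  \<open>Comp\<close> composes only functions on numbers relative to one fixed oracle.\<close>

primrec subst :: "prog \<Rightarrow> prog \<Rightarrow> prog" where
  "subst Zero d = Zero"
| "subst Succ d = Succ"
| "subst Left d = Left"
| "subst Right d = Right"
| "subst Oracle d = d"
| "subst (Pair a b) d = Pair (subst a d) (subst b d)"
| "subst (Comp a b) d = Comp (subst a d) (subst b d)"
| "subst (Prec a b) d = Prec (subst a d) (subst b d)"
| "subst (Mu a) d = Mu (subst a d)"

lemma run_subst:
  assumes "\<And>k. run d p k = Some (h k)" shows "run (subst c d) p x = run c h x"
proof -
  have "run (subst c d) p = run c h"
    by (induction c) (rule ext, simp add: assms)+
  then show ?thesis by simp
qed

lemma map_leD: "F \<subseteq>\<^sub>m G \<Longrightarrow> F x = Some y \<Longrightarrow> G x = Some y"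
  by (force simp: map_le_def)

lemma computableE:
  assumes "computable F" obtains c where "F \<subseteq>\<^sub>m Phi (index c)"
  using assms surj_index unfolding computable_def by (metis surjD)

text \<open>The inner functionals compose to \<open>H2 (H1 p)\<close>, and the outer one sends
  \<open>pair p r\<close> to \<open>K1 (pair p (K2 (pair (H1 p) r)))\<close>.\<close>

lemma weihrauch_le_trans:
  assumes "f \<le>\<^sub>W g" "g \<le>\<^sub>W h" shows "f \<le>\<^sub>W h"
proof -
  obtain K1 H1 where "computable K1" "computable H1"
    and 1: "\<And>G. realizer G g \<Longrightarrow>
           realizer (\<lambda>p. Option.bind (H1 p) (\<lambda>h. Option.bind (G h) (\<lambda>r. K1 (pair p r)))) f"
    using assms(1) unfolding weihrauch_le_def by blast
  obtain K2 H2 where "computable K2" "computable H2"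
    and 2: "\<And>G. realizer G h \<Longrightarrow>
           realizer (\<lambda>p. Option.bind (H2 p) (\<lambda>h. Option.bind (G h) (\<lambda>r. K2 (pair p r)))) g"
    using assms(2) unfolding weihrauch_le_def by blast
  obtain k1 h1 k2 h2 where K1: "K1 \<subseteq>\<^sub>m Phi (index k1)" and H1: "H1 \<subseteq>\<^sub>m Phi (index h1)"
    and K2: "K2 \<subseteq>\<^sub>m Phi (index k2)" and H2: "H2 \<subseteq>\<^sub>m Phi (index h2)"
    using \<open>computable K1\<close> \<open>computable H1\<close> \<open>computable K2\<close> \<open>computable H2\<close>
    by (auto elim!: computableE)
  have "recfun (\<lambda>p x. p (2 * x))" "recfun (\<lambda>p x. p (Suc (2 * x)))"
    "recfun (\<lambda>p x. if even (lft x) then lft (rgt x) else rgt (rgt x))" "recfun (\<lambda>p x. x div 2)"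
    by (intro rec_intros)+
  then obtain lf rt sel hf where lf: "\<And>p x. run lf p x = Some (p (2 * x))"
    and rt: "\<And>p x. run rt p x = Some (p (Suc (2 * x)))"
    and sel: "\<And>p x. run sel p x = Some (if even (lft x) then lft (rgt x) else rgt (rgt x))"
    and hf: "\<And>p x. run hf p x = Some (x div 2)"
    by (auto elim!: recfunE)
  \<comment> \<open>\<open>Pair Left Right\<close> is the identity and hands the parity on to
    \<open>sel\<close>. Both components are evaluated at half the position, so both have to be
    total.\<close>
  define merge where
    "merge c d = Comp sel (Pair (Pair Left Right) (Pair (Comp c hf) (Comp d hf)))" for c d
  have merge: "run (merge c d) p n = Some (pair u v n)"
    if "\<And>k. run c p k = Some (u k)" "\<And>k. run d p k = Some (v k)" for c d p u v n
    by (simp add: merge_def that hf sel pair_def)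
  define H where "H = Phi (index (subst h2 h1))"
  define K where
    "K = Phi (index (subst k1 (merge lf (subst k2 (merge (subst h1 lf) rt)))))"
  have "realizer (\<lambda>p. Option.bind (H p) (\<lambda>h. Option.bind (G h) (\<lambda>r. K (pair p r)))) f"
    if G: "realizer G h" for G
    unfolding realizer_def
  proof (intro allI impI)
    fix p assume "f p \<noteq> {}"
    then obtain q where q: "q \<in> f p" and
      "Option.bind (H1 p) (\<lambda>h. Option.bind
         (Option.bind (H2 h) (\<lambda>h'. Option.bind (G h') (\<lambda>r. K2 (pair h r)))) (\<lambda>r. K1 (pair p r))) = Some q"
      using 1[OF 2[OF G]] unfolding realizer_def by blast
    then obtain x y r s where e: "H1 p = Some x" "H2 x = Some y" "G y = Some r"
      "K2 (pair x r) = Some s" "K1 (pair p s) = Some q"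
      by (auto simp: bind_eq_Some_conv)
    have h1: "run h1 p k = Some (x k)" and h2: "run h2 x k = Some (y k)"
      and k2: "run k2 (pair x r) k = Some (s k)" and k1: "run k1 (pair p s) k = Some (q k)" for k
      using map_leD[OF H1, OF e(1)] map_leD[OF H2, OF e(2)] map_leD[OF K2, OF e(4)] map_leD[OF K1, OF e(5)]
      by (simp_all add: Phi_index_iff)
    have "H p = Some y"
      by (simp add: H_def Phi_index_iff run_subst[OF h1] h2)
    moreover have lf': "run lf (pair p r) k = Some (p k)" and "run rt (pair p r) k = Some (r k)" for k
      by (simp_all add: lf rt)
    then have "run (merge (subst h1 lf) rt) (pair p r) k = Some (pair x r k)" for k
      by (intro merge) (simp_all add: run_subst[OF lf'] h1)
    then have "run (subst k2 (merge (subst h1 lf) rt)) (pair p r) k = Some (s k)" for k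
      by (simp add: run_subst k2)
    then have "run (merge lf (subst k2 (merge (subst h1 lf) rt))) (pair p r) k = Some (pair p s k)" for k
      by (intro merge lf')
    then have "K (pair p r) = Some q"
      by (simp add: K_def Phi_index_iff run_subst k1)
    ultimately show "\<exists>q\<in>f p. Option.bind (H p) (\<lambda>h. Option.bind (G h) (\<lambda>r. K (pair p r))) = Some q"
      using q e(3) by auto
  qed
  moreover have "computable H" "computable K"
    unfolding H_def K_def computable_def by (blast intro: map_le_refl)+
  ultimately show ?thesis unfolding weihrauch_le_def by blast
qed

section \<open>Computable names of closed sets\<close>

text \<open>
  A total functional \<open>B x k y\<close> is continuously computable in \<open>y\<close> if some recursive function
  evaluates it on prefixes of \<open>y\<close>; the value \<open>0\<close> means that the prefix is too short.
\<close>

definition recfun_prefix :: "(baire \<Rightarrow> nat \<Rightarrow> baire \<Rightarrow> nat) \<Rightarrow> bool" where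
  "recfun_prefix B \<longleftrightarrow> (\<exists>E. recfun E \<and> (\<forall>x k y.
     (\<forall>w v. E x (enc k (list_encode w)) = Suc v \<longrightarrow> y \<in> cylinder w \<longrightarrow> B x k y = v) \<and>
     (\<exists>N. \<forall>n\<ge>N. E x (enc k (list_encode (map y [0..<n]))) \<noteq> 0)))"

lemma recfun_prefixI:
  assumes "recfun E"
    and "\<And>x k y w v. E x (enc k (list_encode w)) = Suc v \<Longrightarrow> y \<in> cylinder w \<Longrightarrow> B x k y = v"
    and "\<And>x k y. \<exists>N. \<forall>n\<ge>N. E x (enc k (list_encode (map y [0..<n]))) \<noteq> 0"
  shows "recfun_prefix B"
  using assms unfolding recfun_prefix_def by (intro exI[of _ E]) blast

lemma recfun_prefixE:
  assumes "recfun_prefix B"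
  obtains E where "recfun E"
    "\<And>x k y w v. E x (enc k (list_encode w)) = Suc v \<Longrightarrow> y \<in> cylinder w \<Longrightarrow> B x k y = v"
    "\<And>x k y. \<exists>N. \<forall>n\<ge>N. E x (enc k (list_encode (map y [0..<n]))) \<noteq> 0"
  using assms unfolding recfun_prefix_def by blast

named_theorems prefix_intros

lemma recfun_prefix_const:
  assumes "recfun F" shows "recfun_prefix (\<lambda>x k y. F x k)"
  by (rule recfun_prefixI[of "\<lambda>x z. Suc (F x (lft z))"])
    (auto intro!: rec_intros recfun_compose[OF assms])

lemma recfun_prefix_app:
  assumes "recfun F" "recfun_prefix B" shows "recfun_prefix (\<lambda>x k y. F x (B x k y))"
proof -
  obtain E where E: "recfun E"
    "\<And>x k y w v. E x (enc k (list_encode w)) = Suc v \<Longrightarrow> y \<in> cylinder w \<Longrightarrow> B x k y = v"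
    "\<And>x k y. \<exists>N. \<forall>n\<ge>N. E x (enc k (list_encode (map y [0..<n]))) \<noteq> 0"
    using recfun_prefixE[OF assms(2)] by blast
  show ?thesis
  proof (rule recfun_prefixI[of "\<lambda>x z. if E x z = 0 then 0 else Suc (F x (E x z - Suc 0))"])
    show "recfun (\<lambda>x z. if E x z = 0 then 0 else Suc (F x (E x z - Suc 0)))"
      by (intro rec_intros recfun_compose[OF assms(1)] E(1))
    show "\<exists>N. \<forall>n\<ge>N. (if E x (enc k (list_encode (map y [0..<n]))) = 0 then 0
        else Suc (F x (E x (enc k (list_encode (map y [0..<n]))) - Suc 0))) \<noteq> 0" for x k y
      using E(3)[of x k y] by (metis nat.distinct(1))
  qed (use E(2) in \<open>auto split: if_splits simp: gr0_conv_Suc\<close>)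
qed

lemma recfun_prefix_enc [prefix_intros]:
  assumes "recfun_prefix B" "recfun_prefix C" shows "recfun_prefix (\<lambda>x k y. enc (B x k y) (C x k y))"
proof -
  obtain E where E: "recfun E"
    "\<And>x k y w v. E x (enc k (list_encode w)) = Suc v \<Longrightarrow> y \<in> cylinder w \<Longrightarrow> B x k y = v"
    "\<And>x k y. \<exists>N. \<forall>n\<ge>N. E x (enc k (list_encode (map y [0..<n]))) \<noteq> 0"
    using recfun_prefixE[OF assms(1)] by blast
  obtain F where F: "recfun F"
    "\<And>x k y w v. F x (enc k (list_encode w)) = Suc v \<Longrightarrow> y \<in> cylinder w \<Longrightarrow> C x k y = v"
    "\<And>x k y. \<exists>N. \<forall>n\<ge>N. F x (enc k (list_encode (map y [0..<n]))) \<noteq> 0"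
    using recfun_prefixE[OF assms(2)] by blast
  let ?G = "\<lambda>x z. if E x z = 0 then 0 else if F x z = 0 then 0 else
     Suc (enc (E x z - Suc 0) (F x z - Suc 0))"
  show ?thesis
  proof (rule recfun_prefixI[of ?G])
    show "recfun ?G"
      by (intro rec_intros E(1) F(1))
    show "\<exists>N. \<forall>n\<ge>N. ?G x (enc k (list_encode (map y [0..<n]))) \<noteq> 0" for x k y
    proof -
      obtain N M where "\<forall>n\<ge>N. E x (enc k (list_encode (map y [0..<n]))) \<noteq> 0"
        "\<forall>n\<ge>M. F x (enc k (list_encode (map y [0..<n]))) \<noteq> 0"
        using E(3) F(3) by meson
      then show ?thesis by (intro exI[of _ "max N M"]) auto
    qed
    show "enc (B x k y) (C x k y) = v"
      if "?G x (enc k (list_encode w)) = Suc v" "y \<in> cylinder w" for x k y w v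
      using E(2)[OF _ that(2), of x k] F(2)[OF _ that(2), of x k] that(1)
      by (cases "E x (enc k (list_encode w))"; cases "F x (enc k (list_encode w))") auto
  qed
qed

text \<open>Reading is what makes a prefix too short. Once \<open>B\<close> has been evaluated the
  position is known, and every longer prefix that reaches beyond it suffices.\<close>

lemma recfun_prefix_read [prefix_intros]:
  assumes "recfun_prefix B" shows "recfun_prefix (\<lambda>x k y. y (B x k y))"
proof -
  obtain E where E: "recfun E"
    "\<And>x k y w v. E x (enc k (list_encode w)) = Suc v \<Longrightarrow> y \<in> cylinder w \<Longrightarrow> B x k y = v"
    "\<And>x k y. \<exists>N. \<forall>n\<ge>N. E x (enc k (list_encode (map y [0..<n]))) \<noteq> 0"
    using recfun_prefixE[OF assms] by blast
  let ?G = "\<lambda>x z. if E x z = 0 then 0 else if code_len (rgt z) \<le> E x z - Suc 0 then 0 else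
     Suc (code_nth (rgt z) (E x z - Suc 0))"
  show ?thesis
  proof (rule recfun_prefixI[of ?G])
    show "recfun ?G"
      by (intro rec_intros E(1))
    show "\<exists>N. \<forall>n\<ge>N. ?G x (enc k (list_encode (map y [0..<n]))) \<noteq> 0" for x k y
    proof -
      obtain N where N: "\<forall>n\<ge>N. E x (enc k (list_encode (map y [0..<n]))) \<noteq> 0"
        using E(3) by meson
      have "?G x (enc k (list_encode (map y [0..<n]))) \<noteq> 0" if n: "n \<ge> max N (Suc (B x k y))" for n
      proof -
        obtain v where v: "E x (enc k (list_encode (map y [0..<n]))) = Suc v"
          using N n by (meson max.boundedE not0_implies_Suc)
        then have "B x k y = v"
          by (rule E(2)) (simp add: cylinder_def)
        then show ?thesis using v n by simp
      qed
      then show ?thesis by blast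
    qed
    show "y (B x k y) = v"
      if "?G x (enc k (list_encode w)) = Suc v" "y \<in> cylinder w" for x k y w v
      using E(2)[OF _ that(2), of x k] that
      by (cases "E x (enc k (list_encode w))") (auto split: if_splits simp: cylinder_def)
  qed
qed

lemma recfun_prefix_app2:
  assumes "recfun (\<lambda>x z. F x (lft z) (rgt z))" "recfun_prefix B" "recfun_prefix C"
  shows "recfun_prefix (\<lambda>x k y. F x (B x k y) (C x k y))"
  using recfun_prefix_app[OF assms(1) recfun_prefix_enc[OF assms(2,3)]] by simp

lemma recfun_prefix_unary [prefix_intros]:
  assumes "recfun_prefix B"
  shows "recfun_prefix (\<lambda>x k y. Suc (B x k y))"
    and "recfun_prefix (\<lambda>x k y. B x k y - Suc 0)"
    and "recfun_prefix (\<lambda>x k y. lft (B x k y))"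
    and "recfun_prefix (\<lambda>x k y. rgt (B x k y))"
    and "recfun_prefix (\<lambda>x k y. x (B x k y))"
  by (rule recfun_prefix_app[OF _ assms]; intro rec_intros)+

lemma recfun_prefix_binary [prefix_intros]:
  assumes "recfun_prefix B" "recfun_prefix C"
  shows "recfun_prefix (\<lambda>x k y. B x k y + C x k y)"
    and "recfun_prefix (\<lambda>x k y. B x k y * C x k y)"
    and "recfun_prefix (\<lambda>x k y. of_bool (B x k y = C x k y))"
    and "recfun_prefix (\<lambda>x k y. of_bool (B x k y \<le> C x k y))"
  by (rule recfun_prefix_app2[OF _ assms]; intro rec_intros)+

lemma recfun_prefix_not [prefix_intros]:
  assumes "recfun_prefix (\<lambda>x k y. of_bool (P x k y))"
  shows "recfun_prefix (\<lambda>x k y. of_bool (\<not> P x k y))"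
proof -
  have "recfun_prefix (\<lambda>x k y. of_bool (\<not> of_bool (P x k y) = (1::nat)))"
    by (rule recfun_prefix_app[OF _ assms(1)]) (intro rec_intros)
  then show "recfun_prefix (\<lambda>x k y. of_bool (\<not> P x k y))" by (simp del: One_nat_def)
qed

lemma recfun_prefix_bool [prefix_intros]:
  assumes "recfun_prefix (\<lambda>x k y. of_bool (P x k y))" "recfun_prefix (\<lambda>x k y. of_bool (Q x k y))"
  shows "recfun_prefix (\<lambda>x k y. of_bool (P x k y \<and> Q x k y))"
    and "recfun_prefix (\<lambda>x k y. of_bool (P x k y \<longrightarrow> Q x k y))"
    and "recfun_prefix (\<lambda>x k y. of_bool (P x k y \<longleftrightarrow> Q x k y))"
proof -
  have "recfun_prefix (\<lambda>x k y. of_bool (of_bool (P x k y) = (1::nat) \<and> of_bool (Q x k y) = (1::nat)))"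
    by (rule recfun_prefix_app2[OF _ assms]) (intro rec_intros)
  then show "recfun_prefix (\<lambda>x k y. of_bool (P x k y \<and> Q x k y))" by (simp del: One_nat_def)
  have "recfun_prefix (\<lambda>x k y. of_bool (of_bool (P x k y) = (1::nat) \<longrightarrow> of_bool (Q x k y) = (1::nat)))"
    by (rule recfun_prefix_app2[OF _ assms]) (intro rec_intros)
  then show "recfun_prefix (\<lambda>x k y. of_bool (P x k y \<longrightarrow> Q x k y))" by (simp del: One_nat_def)
  have "recfun_prefix (\<lambda>x k y. of_bool (of_bool (P x k y) = (1::nat) \<longleftrightarrow> of_bool (Q x k y) = (1::nat)))"
    by (rule recfun_prefix_app2[OF _ assms]) (intro rec_intros)
  then show "recfun_prefix (\<lambda>x k y. of_bool (P x k y \<longleftrightarrow> Q x k y))" by (simp del: One_nat_def)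
qed

text \<open>Both branches are evaluated before one is selected, which is harmless for total
  functionals.\<close>

lemma recfun_prefix_If [prefix_intros]:
  assumes "recfun_prefix (\<lambda>x k y. of_bool (P x k y))" "recfun_prefix B" "recfun_prefix C"
  shows "recfun_prefix (\<lambda>x k y. if P x k y then B x k y else C x k y)"
proof -
  have "recfun_prefix (\<lambda>x k y. if of_bool (P x k y) = (1::nat) then lft (enc (B x k y) (C x k y))
      else rgt (enc (B x k y) (C x k y)))"
    by (rule recfun_prefix_app2[OF _ assms(1) recfun_prefix_enc[OF assms(2,3)]]) (intro rec_intros)
  then show ?thesis by (simp del: One_nat_def cong: if_cong)
qed

lemma prefix_in_cylinder: "y \<in> cylinder w \<longleftrightarrow> (\<exists>n. w = map y [0..<n])"
proof
  assume "y \<in> cylinder w"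
  then have "w = map y [0..<length w]" by (auto simp: cylinder_def intro: nth_equalityI)
  then show "\<exists>n. w = map y [0..<n]" ..
qed (auto simp: cylinder_def)

text \<open>A violated condition is already violated on a finite prefix. So stage
  \<open>enc k w\<close> enumerates \<open>w\<close> if \<open>E\<close> returns
  \<open>Suc 0\<close> there, that is, if condition \<open>k\<close> evaluates to False on the
  prefix \<open>w\<close>.\<close>

lemma closed_name:
  assumes "recfun_prefix (\<lambda>x k y. of_bool (P x k y))"
  obtains E where "recfun E" "\<And>x. delta_closed (E x) = Some {y. \<forall>k. P x k y}"
proof -
  obtain E where E: "recfun E"
    "\<And>x k y w v. E x (enc k (list_encode w)) = Suc v \<Longrightarrow> y \<in> cylinder w \<Longrightarrow> of_bool (P x k y) = v"
    "\<And>x k y. \<exists>N. \<forall>n\<ge>N. E x (enc k (list_encode (map y [0..<n]))) \<noteq> 0"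
    using recfun_prefixE[OF assms] by blast
  define F where "F x z = (if E x z = Suc 0 then Suc (rgt z) else 0)" for x z
  have "recfun F"
    unfolding F_def by (intro rec_intros E(1))
  moreover have iff: "(\<exists>w. (\<exists>n. F x n = Suc (list_encode w)) \<and> y \<in> cylinder w) \<longleftrightarrow> (\<exists>k. \<not> P x k y)" for x y
  proof
    assume "\<exists>w. (\<exists>n. F x n = Suc (list_encode w)) \<and> y \<in> cylinder w"
    then obtain w z where wz: "F x z = Suc (list_encode w)" "y \<in> cylinder w" by blast
    then have "E x (enc (lft z) (list_encode w)) = Suc 0"
      by (metis F_def Suc_inject enc_lft_rgt nat.distinct(1))
    from E(2)[OF this wz(2)] show "\<exists>k. \<not> P x k y" by auto
  next
    assume "\<exists>k. \<not> P x k y"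
    then obtain k where k: "\<not> P x k y" by blast
    obtain n where n: "E x (enc k (list_encode (map y [0..<n]))) \<noteq> 0"
      using E(3) by blast
    let ?w = "map y [0..<n]"
    have "y \<in> cylinder ?w" by (auto simp: prefix_in_cylinder)
    moreover have "E x (enc k (list_encode ?w)) = Suc 0"
      using E(2)[of x k ?w _ y] \<open>y \<in> cylinder ?w\<close> n k by (cases "E x (enc k (list_encode ?w))") auto
    ultimately show "\<exists>w. (\<exists>n. F x n = Suc (list_encode w)) \<and> y \<in> cylinder w"
      by (intro exI[of _ ?w] conjI exI[of _ "enc k (list_encode ?w)"]) (simp_all add: F_def)
  qed
  have "y \<in> - (\<Union>w \<in> {w. \<exists>n. F x n = Suc (list_encode w)}. cylinder w) \<longleftrightarrow> (\<forall>k. P x k y)" for x y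
    using iff[of x y] by (simp, meson)
  then have "delta_closed (F x) = Some {y. \<forall>k. P x k y}" for x
    unfolding delta_closed_def by (simp add: set_eq_iff)
  ultimately show thesis using that by blast
qed

lemma UC_Baire_singleton: "delta_closed p = Some {x} \<Longrightarrow> UC_Baire p = {x}"
  by (auto simp: UC_Baire_def on_names_def UC_map_def)

lemma weihrauch_le_UC_I:
  assumes "recfun_prefix (\<lambda>x k y. of_bool (P x k y))" "recfun K"
    and "\<And>x r. r \<in> f x \<Longrightarrow> \<exists>y. {y. \<forall>k. P x k y} = {y} \<and> K y \<in> f x"
  shows "f \<le>\<^sub>W UC_Baire"
proof -
  obtain E where E: "recfun E" "\<And>x. delta_closed (E x) = Some {y. \<forall>k. P x k y}"
    using closed_name[OF assms(1)] by blast
  obtain c where c: "\<And>p k. run c p k = Some (K p k)" using recfunE[OF assms(2)] by blast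
  have "recfun (\<lambda>p x. p (Suc (2 * x)))" by (intro rec_intros)
  then obtain d where d: "\<And>p x. run d p x = Some (p (Suc (2 * x)))" by (rule recfunE) blast
  define F where "F = Phi (index (subst c d))"
  have F: "F (pair p y) = Some (K y)" for p y
    by (simp add: F_def Phi_index_iff run_subst[where h=y] d c)
  have "realizer (\<lambda>p. Option.bind (Some (E p)) (\<lambda>h. Option.bind (G h) (\<lambda>r. F (pair p r)))) f"
    if G: "realizer G UC_Baire" for G
    unfolding realizer_def
  proof (intro allI impI)
    fix x assume "f x \<noteq> {}"
    then obtain y where y: "{y. \<forall>k. P x k y} = {y}" "K y \<in> f x" using assms(3) by blast
    then have "UC_Baire (E x) = {y}" using E(2) by (simp add: UC_Baire_singleton)
    then have "G (E x) = Some y" using G unfolding realizer_def by (metis insert_not_empty singletonD)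
    then show "\<exists>q\<in>f x. Option.bind (Some (E x)) (\<lambda>h. Option.bind (G h) (\<lambda>r. F (pair x r))) = Some q"
      using y F by simp
  qed
  moreover have "computable F" unfolding F_def computable_def by (blast intro: map_le_refl)
  ultimately show ?thesis
    unfolding weihrauch_le_def using computable_recfun[OF E(1)] by blast
qed

section \<open>Run tables of programs\<close>

definition run_table :: "baire \<Rightarrow> nat \<Rightarrow> nat \<Rightarrow> nat" where
  "run_table h n k = (case run (inv index n) h k of None \<Rightarrow> 0 | Some v \<Rightarrow> Suc v)"

text \<open>In a run table, 0 is divergence, 1 is the value zero, and entries from 2 on are nonzero
  values. So the table is 1 as long as the search has neither succeeded nor got stuck.\<close>

definition search_table :: "baire \<Rightarrow> nat \<Rightarrow> nat \<Rightarrow> nat \<Rightarrow> nat" where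
  "search_table h n k m = of_bool (\<forall>j<m. 2 \<le> run_table h n (enc k j))"

lemma run_table_index: "run_table h (index c) k = (case run c h k of None \<Rightarrow> 0 | Some v \<Rightarrow> Suc v)"
  by (simp add: run_table_def inj_index)

lemma Phi_run_table: "Phi n h = Some z \<longleftrightarrow> (\<forall>k. run_table h n k = Suc (z k))"
proof -
  obtain c where "n = index c" using surj_index by (metis surjD)
  then show ?thesis by (auto simp: Phi_index_iff run_table_index split: option.splits)
qed

text \<open>
  A step-counting universal program is avoided: the graph of all programs on the oracle \<open>h\<close> is
  the only table \<open>T\<close> that is locally consistent with the semantics of programs, where \<open>0\<close>
  codes divergence. The table \<open>N\<close> records which unbounded searches have not ended yet.
\<close>

definition table_cond ::
    "baire \<Rightarrow> (nat \<Rightarrow> nat \<Rightarrow> nat) \<Rightarrow> (nat \<Rightarrow> nat \<Rightarrow> nat \<Rightarrow> nat) \<Rightarrow> nat \<Rightarrow> nat \<Rightarrow> nat \<Rightarrow> nat \<Rightarrow> bool" where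
  "table_cond h T N a b k n \<longleftrightarrow>
     T 0 k = 1 \<and> T 1 k = Suc (Suc k) \<and> T 2 k = Suc (lft k) \<and> T 3 k = Suc (rgt k) \<and> T 4 k = Suc (h k) \<and>
     T (5 + 4 * enc a b) k =
       (if T a k = 0 then 0 else if T b k = 0 then 0 else Suc (enc (T a k - Suc 0) (T b k - Suc 0))) \<and>
     T (6 + 4 * enc a b) k = (if T b k = 0 then 0 else T a (T b k - Suc 0)) \<and>
     T (7 + 4 * enc a b) (enc k 0) = T a k \<and>
     T (7 + 4 * enc a b) (enc k (Suc n)) =
       (if T (7 + 4 * enc a b) (enc k n) = 0 then 0
        else T b (enc k (enc n (T (7 + 4 * enc a b) (enc k n) - Suc 0)))) \<and>
     N a k 0 = 1 \<and> N a k (Suc n) = of_bool (N a k n = 1 \<and> 2 \<le> T a (enc k n)) \<and>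
     (T (8 + 4 * a) k = Suc n \<longleftrightarrow> N a k n = 1 \<and> T a (enc k n) = 1)"

text \<open>An earlier zero would itself end the search, so minimality turns "defined before
  \<open>n\<close>" into "defined and nonzero before \<open>n\<close>", which is what
  \<open>search_table\<close> records.\<close>

lemma run_Mu_Some:
  "run (Mu c) h x = Some n \<longleftrightarrow>
     run c h (enc x n) = Some 0 \<and> (\<forall>m<n. \<exists>v. run c h (enc x m) = Some (Suc v))"
    (is "_ \<longleftrightarrow> ?R n")
proof -
  define P where "P n \<longleftrightarrow> run c h (enc x n) = Some 0 \<and> (\<forall>m<n. run c h (enc x m) \<noteq> None)" for n
  have run: "run (Mu c) h x = (if \<exists>n. P n then Some (LEAST n. P n) else None)"
    unfolding P_def by (simp add: Let_def)
  have R: "?R n \<longleftrightarrow> P n \<and> (\<forall>m<n. \<not> P m)" for n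
  proof
    assume "P n \<and> (\<forall>m<n. \<not> P m)"
    then have P: "P n" and neg: "\<And>m. m < n \<Longrightarrow> \<not> P m" by auto
    have "\<exists>v. run c h (enc x m) = Some (Suc v)" if "m < n" for m
    proof -
      have "run c h (enc x m) \<noteq> None" using P that by (simp add: P_def)
      then obtain v where v: "run c h (enc x m) = Some v" by blast
      moreover have "P m" if "v = 0" using P \<open>m < n\<close> v that less_trans unfolding P_def by blast
      then have "v \<noteq> 0" using neg[OF that] by blast
      ultimately show ?thesis by (auto simp: gr0_conv_Suc)
    qed
    then show "?R n" using P by (simp add: P_def)
  qed (force simp: P_def)
  have "(\<exists>k. P k) \<and> (LEAST k. P k) = n \<longleftrightarrow> P n \<and> (\<forall>m<n. \<not> P m)"
    by (metis (full_types) LeastI Least_equality not_less_Least linorder_not_le)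
  then show ?thesis unfolding R run by auto
qed

lemma table_cond_run_table: "table_cond h (run_table h) (search_table h) a b k n"
proof -
  obtain c d where ab: "a = index c" "b = index d" using surj_index by (metis surjD)
  have "run_table h 0 k = 1" "run_table h 1 k = Suc (Suc k)" "run_table h 2 k = Suc (lft k)"
    "run_table h 3 k = Suc (rgt k)" "run_table h 4 k = Suc (h k)"
    using run_table_index[of h Zero k] run_table_index[of h Succ k] run_table_index[of h Left k]
      run_table_index[of h Right k] run_table_index[of h Oracle k]
    by (simp_all add: lft_def rgt_def)
  moreover have "run_table h (5 + 4 * enc a b) k = (if run_table h a k = 0 then 0
      else if run_table h b k = 0 then 0 else Suc (enc (run_table h a k - Suc 0) (run_table h b k - Suc 0)))"
    using run_table_index[of h "Pair c d" k] by (simp add: ab run_table_index split: option.split)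
  moreover have "run_table h (6 + 4 * enc a b) k =
      (if run_table h b k = 0 then 0 else run_table h a (run_table h b k - Suc 0))"
    using run_table_index[of h "Comp c d" k] by (simp add: ab run_table_index split: option.split)
  moreover have "run_table h (7 + 4 * enc a b) (enc k 0) = run_table h a k"
    using run_table_index[of h "Prec c d" "enc k 0"] by (simp add: ab run_table_index)
  moreover have "run_table h (7 + 4 * enc a b) (enc k (Suc n)) =
       (if run_table h (7 + 4 * enc a b) (enc k n) = 0 then 0
        else run_table h b (enc k (enc n (run_table h (7 + 4 * enc a b) (enc k n) - Suc 0))))"
    using run_table_index[of h "Prec c d" "enc k (Suc n)"] run_table_index[of h "Prec c d" "enc k n"]
    by (simp add: ab run_table_index split: option.split)
  moreover have "search_table h a k 0 = 1"
    "search_table h a k (Suc n) = of_bool (search_table h a k n = 1 \<and> 2 \<le> run_table h a (enc k n))"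
    by (auto simp: search_table_def less_Suc_eq)
  moreover have "run_table h (8 + 4 * a) k = Suc n \<longleftrightarrow>
     search_table h a k n = 1 \<and> run_table h a (enc k n) = 1"
  proof -
    have "run_table h (8 + 4 * a) k = Suc n \<longleftrightarrow> run (Mu c) h k = Some n"
      using run_table_index[of h "Mu c" k] by (simp add: ab split: option.split)
    moreover have "2 \<le> run_table h a j \<longleftrightarrow> (\<exists>v. run c h j = Some (Suc v))" for j
      by (auto simp: ab run_table_index Suc_le_eq numeral_2_eq_2 gr0_conv_Suc split: option.split)
    moreover have "run_table h a j = 1 \<longleftrightarrow> run c h j = Some 0" for j
      by (simp add: ab run_table_index split: option.split)
    ultimately show ?thesis
      by (simp only: run_Mu_Some search_table_def of_bool_eq_1_iff) blast
  qed
  ultimately show ?thesis unfolding table_cond_def by blast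
qed

text \<open>Induction on programs. The delicate case is a divergent \<open>Mu\<close>: no single
  condition asserts the entry 0, but for each \<open>n\<close> it is settled whether the entry
  equals \<open>Suc n\<close>, and this determines it.\<close>

lemma table_cond_unique:
  assumes "\<And>a b k n. table_cond h T N a b k n"
  shows "T = run_table h" "N = search_table h"
proof -
  note T = assms[unfolded table_cond_def]
  note R = table_cond_run_table[of h, unfolded table_cond_def]
  have search: "N a k n = search_table h a k n" if "T a = run_table h a" for a k n
  proof (induction n)
    case 0 show ?case using T R by metis
  next
    case (Suc n) then show ?case using assms[of a 0 k n, unfolded table_cond_def] table_cond_run_table[of h a 0 k n, unfolded table_cond_def] that by simp
  qed
  have "T (index c) = run_table h (index c)" for c
  proof (induction c)
    case Zero show ?case using T R by (auto simp: fun_eq_iff)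
  next
    case Succ show ?case using T R by (auto simp: fun_eq_iff)
  next
    case Left show ?case using T R by (auto simp: fun_eq_iff)
  next
    case Right show ?case using T R by (auto simp: fun_eq_iff)
  next
    case Oracle show ?case using T R by (auto simp: fun_eq_iff)
  next
    case (Pair c d)
    show ?case
    proof
      fix k show "T (index (Pair c d)) k = run_table h (index (Pair c d)) k"
        using assms[of "index c" "index d" k 0, unfolded table_cond_def] table_cond_run_table[of h "index c" "index d" k 0, unfolded table_cond_def] Pair by simp
    qed
  next
    case (Comp c d)
    show ?case
    proof
      fix k show "T (index (Comp c d)) k = run_table h (index (Comp c d)) k"
        using assms[of "index c" "index d" k 0, unfolded table_cond_def] table_cond_run_table[of h "index c" "index d" k 0, unfolded table_cond_def] Comp by simp
    qed
  next
    case (Prec c d)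
    have "T (index (Prec c d)) (enc k n) = run_table h (index (Prec c d)) (enc k n)" for k n
    proof (induction n)
      case 0
      show ?case using assms[of "index c" "index d" k 0, unfolded table_cond_def] table_cond_run_table[of h "index c" "index d" k 0, unfolded table_cond_def] Prec by simp
    next
      case (Suc n)
      then show ?case using assms[of "index c" "index d" k n, unfolded table_cond_def] table_cond_run_table[of h "index c" "index d" k n, unfolded table_cond_def] Prec by simp
    qed
    then show ?case by (metis enc_lft_rgt ext)
  next
    case (Mu c)
    show ?case
    proof
      fix k
      have "T (index (Mu c)) k = Suc n \<longleftrightarrow> run_table h (index (Mu c)) k = Suc n" for n
        using assms[of "index c" 0 k n, unfolded table_cond_def] table_cond_run_table[of h "index c" 0 k n, unfolded table_cond_def] Mu search[OF Mu, of k n] by simp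
      then show "T (index (Mu c)) k = run_table h (index (Mu c)) k"
        by (metis not0_implies_Suc)
    qed
  qed
  then show *: "T = run_table h" using surj_index by (metis ext surjD)
  show "N = search_table h" using search * by blast
qed

section \<open>Reducing the iteration to unique choice\<close>

text \<open>The graph of \<open>f\<close> is a closed condition with a unique witness \<mu>. Each
  instance of the condition looks at one entry of the result, of the witness and of the argument, so
  that it can be checked inside a record; \<open>c\<close> selects the entry of the
  argument.\<close>

locale pi01_graph =
  fixes f :: "baire \<Rightarrow> baire set" and Q :: "nat \<Rightarrow> nat \<Rightarrow> nat \<Rightarrow> nat \<Rightarrow> nat \<Rightarrow> bool" and c :: "nat \<Rightarrow> nat \<Rightarrow> nat"
  assumes graph: "s \<in> f z \<longleftrightarrow> (\<exists>\<mu>. \<forall>a b. Q a b (s a) (\<mu> a) (z (c a b)))"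
    and unique_witness: "\<forall>a b. Q a b (s a) (\<mu> a) (z (c a b)) \<Longrightarrow>
      \<forall>a b. Q a b (t a) (\<nu> a) (z (c a b)) \<Longrightarrow> s = t \<and> \<mu> = \<nu>"
    and recfun_Q: "recfun (\<lambda>x v. of_bool (Q (lft v) (lft (rgt v)) (lft (rgt (rgt v)))
      (lft (rgt (rgt (rgt v)))) (rgt (rgt (rgt (rgt v))))))"
    and recfun_c: "recfun (\<lambda>x v. c (lft v) (rgt v))"
begin

lemma single_valued: "s \<in> f z \<Longrightarrow> t \<in> f z \<Longrightarrow> s = t"
  using unique_witness by (metis graph)

lemma prefix_Q [prefix_intros]:
  assumes "recfun_prefix A1" "recfun_prefix A2" "recfun_prefix A3" "recfun_prefix A4" "recfun_prefix A5"
  shows "recfun_prefix (\<lambda>x k y. of_bool (Q (A1 x k y) (A2 x k y) (A3 x k y) (A4 x k y) (A5 x k y)))"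
  using recfun_prefix_app[OF recfun_Q recfun_prefix_enc[OF assms(1) recfun_prefix_enc[OF assms(2)
    recfun_prefix_enc[OF assms(3) recfun_prefix_enc[OF assms(4,5)]]]]] by simp

lemma prefix_c [prefix_intros]:
  assumes "recfun_prefix A1" "recfun_prefix A2"
  shows "recfun_prefix (\<lambda>x k y. c (A1 x k y) (A2 x k y))"
  using recfun_prefix_app[OF recfun_c recfun_prefix_enc[OF assms]] by simp

text \<open>
  A record of the evaluation of \<open>f\<^sup>\<dagger>\<close> at \<open>x\<close> consists of tables for every node \<open>\<sigma>\<close> of
  the name, addressed by codes of lists with the last branch first: \<open>cell y 0 \<sigma>\<close> and \<open>cell y 1 \<sigma>\<close>
  are the two parts of the input at \<open>\<sigma>\<close>, \<open>cell y 2 \<sigma>\<close> is the result, \<open>cell y 3 \<sigma>\<close> and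
  \<open>cell y 4 \<sigma>\<close> are the run and search tables relative to this result, and \<open>cell y 5 \<sigma>\<close> is
  the witness for the application of \<open>f\<close>.
\<close>

definition cell :: "baire \<Rightarrow> nat \<Rightarrow> nat \<Rightarrow> nat \<Rightarrow> nat" where
  "cell y t \<sigma> k = y (enc t (enc \<sigma> k))"

text \<open>Every address needs a definite content: below a leaf stands the constant zero input,
  which is a leaf again, and tables from 6 on are 0. A successor node repeats its only child at
  every branch, and branch 0 represents it.\<close>

definition node_cond :: "baire \<Rightarrow> baire \<Rightarrow> nat \<Rightarrow> nat \<Rightarrow> nat \<Rightarrow> bool" where
  "node_cond x y \<sigma> a k \<longleftrightarrow>
     cell y 0 0 k = x (2 * k) \<and> cell y 1 0 k = x (Suc (2 * k)) \<and>
     cell y 0 (Suc (enc a \<sigma>)) k = (if cell y 0 \<sigma> 0 = 1 then cell y 0 \<sigma> (Suc k)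
       else if cell y 0 \<sigma> 0 = 2 then cell y 0 \<sigma> (Suc (enc a k)) else 0) \<and>
     cell y 1 (Suc (enc a \<sigma>)) k = (if cell y 0 \<sigma> 0 = 1 then cell y 1 \<sigma> (Suc k)
       else if cell y 0 \<sigma> 0 = 2 then cell y 1 \<sigma> (enc a k) else 0) \<and>
     cell y (6 + a) \<sigma> k = 0"

text \<open>At a successor node the first input entry is a program index. The argument of
  \<open>f\<close> is read off the run table of the child: nonzero entries mean convergence, and
  \<open>- Suc 0\<close> recovers the value.\<close>

definition result_cond :: "baire \<Rightarrow> nat \<Rightarrow> nat \<Rightarrow> nat \<Rightarrow> nat \<Rightarrow> bool" where
  "result_cond y \<sigma> a b k \<longleftrightarrow>
     (cell y 0 \<sigma> 0 = 2 \<longrightarrow> cell y 2 \<sigma> (enc a k) = cell y 2 (Suc (enc a \<sigma>)) k) \<and>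
     (cell y 0 \<sigma> 0 = 1 \<longrightarrow>
        cell y 2 \<sigma> (Suc (2 * k)) = cell y 2 (Suc (enc 0 \<sigma>)) k \<and>
        \<not> cell y 3 (Suc (enc 0 \<sigma>)) (enc (cell y 1 \<sigma> 0) k) = 0 \<and>
        Q a b (cell y 2 \<sigma> (2 * a)) (cell y 5 \<sigma> a)
          (cell y 3 (Suc (enc 0 \<sigma>)) (enc (cell y 1 \<sigma> 0) (c a b)) - Suc 0)) \<and>
     (\<not> cell y 0 \<sigma> 0 = 1 \<longrightarrow> cell y 5 \<sigma> k = 0) \<and>
     (\<not> cell y 0 \<sigma> 0 = 1 \<longrightarrow> \<not> cell y 0 \<sigma> 0 = 2 \<longrightarrow> cell y 2 \<sigma> k = cell y 1 \<sigma> k)"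

definition table_cond_at :: "baire \<Rightarrow> nat \<Rightarrow> nat \<Rightarrow> nat \<Rightarrow> nat \<Rightarrow> nat \<Rightarrow> bool" where
  "table_cond_at y \<sigma> = table_cond (cell y 2 \<sigma>) (\<lambda>n k. cell y 3 \<sigma> (enc n k))
     (\<lambda>n k m. cell y 4 \<sigma> (enc n (enc k m)))"

definition record_cond :: "baire \<Rightarrow> nat \<Rightarrow> baire \<Rightarrow> bool" where
  "record_cond x v y \<longleftrightarrow>
     (let \<sigma> = lft v; a = lft (rgt v); b = lft (rgt (rgt v));
        k = lft (rgt (rgt (rgt v))); n = rgt (rgt (rgt (rgt v)))
      in node_cond x y \<sigma> a k \<and> result_cond y \<sigma> a b k \<and> table_cond_at y \<sigma> a b k n)"

lemma record_cond_all:
  "(\<forall>v. record_cond x v y) \<longleftrightarrow>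
     (\<forall>\<sigma> a b k n. node_cond x y \<sigma> a k \<and> result_cond y \<sigma> a b k \<and> table_cond_at y \<sigma> a b k n)"
proof (intro iffI allI)
  fix \<sigma> a b k n assume "\<forall>v. record_cond x v y"
  then have "record_cond x (enc \<sigma> (enc a (enc b (enc k n)))) y" by blast
  then show "node_cond x y \<sigma> a k \<and> result_cond y \<sigma> a b k \<and> table_cond_at y \<sigma> a b k n"
    by (simp add: record_cond_def)
qed (simp add: record_cond_def Let_def)

lemma recfun_prefix_record_cond: "recfun_prefix (\<lambda>x v y. of_bool (record_cond x v y))"
proof -
  note [prefix_intros] = recfun_prefix_const[OF recfun_id] recfun_prefix_const[OF recfun_const]
  have A: "recfun_prefix (\<lambda>x v y. of_bool (node_cond x y (lft v) (lft (rgt v)) (lft (rgt (rgt (rgt v))))))"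
    unfolding node_cond_def cell_def by (intro prefix_intros)
  have B: "recfun_prefix (\<lambda>x v y. of_bool (result_cond y (lft v) (lft (rgt v)) (lft (rgt (rgt v))) (lft (rgt (rgt (rgt v))))))"
    unfolding result_cond_def cell_def by (intro prefix_intros)
  have C: "recfun_prefix (\<lambda>x v y. of_bool (table_cond_at y (lft v) (lft (rgt v)) (lft (rgt (rgt v)))
      (lft (rgt (rgt (rgt v)))) (rgt (rgt (rgt (rgt v))))))"
    unfolding table_cond_at_def table_cond_def cell_def by (intro prefix_intros)
  show ?thesis
    unfolding record_cond_def Let_def by (intro prefix_intros A B C)
qed

section \<open>Nodes of a name and their results\<close>

primrec node :: "baire \<Rightarrow> nat list \<Rightarrow> baire \<times> baire" where
  "node x [] = (\<lambda>k. x (2 * k), \<lambda>k. x (Suc (2 * k)))"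
| "node x (i # \<sigma>) = (let (p, q) = node x \<sigma> in
     if p 0 = 1 then (\<lambda>k. p (Suc k), \<lambda>k. q (Suc k))
     else if p 0 = 2 then (\<lambda>k. p (Suc (enc i k)), \<lambda>k. q (enc i k))
     else (\<lambda>_. 0, \<lambda>_. 0))"

definition node_name :: "baire \<Rightarrow> nat \<Rightarrow> baire" where "node_name x \<sigma> = fst (node x (list_decode \<sigma>))"
definition node_prog :: "baire \<Rightarrow> nat \<Rightarrow> baire" where "node_prog x \<sigma> = snd (node x (list_decode \<sigma>))"

lemma node_root: "node_name x 0 = (\<lambda>k. x (2 * k))" "node_prog x 0 = (\<lambda>k. x (Suc (2 * k)))"
  by (simp_all add: node_name_def node_prog_def)

lemma node_child:
  "node_name x (Suc (enc a \<sigma>)) = (if node_name x \<sigma> 0 = 1 then (\<lambda>k. node_name x \<sigma> (Suc k))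
       else if node_name x \<sigma> 0 = 2 then (\<lambda>k. node_name x \<sigma> (Suc (enc a k))) else (\<lambda>k. 0))"
  "node_prog x (Suc (enc a \<sigma>)) = (if node_name x \<sigma> 0 = 1 then (\<lambda>k. node_prog x \<sigma> (Suc k))
       else if node_name x \<sigma> 0 = 2 then (\<lambda>k. node_prog x \<sigma> (enc a k)) else (\<lambda>k. 0))"
  by (simp_all add: node_name_def node_prog_def case_prod_beta Let_def)

lemma address_induct [case_names root child]:
  assumes "P 0" "\<And>a \<sigma>. P \<sigma> \<Longrightarrow> P (Suc (enc a \<sigma>))" shows "P (\<sigma>::nat)"
proof -
  have "P (list_encode w)" for w by (induction w) (simp_all add: assms)
  then show ?thesis by (metis list_decode_inverse)
qed

abbreviation node_result :: "baire \<Rightarrow> nat \<Rightarrow> baire \<Rightarrow> bool" where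
  "node_result x \<sigma> r \<equiv> dagger_rel f (pair (node_name x \<sigma>) (node_prog x \<sigma>)) r"

text \<open>Each clause of the iteration needs results at the children. The dummy nodes below a leaf
  are leaves themselves and have a result trivially.\<close>

lemma node_result_ex:
  assumes "dagger_rel f x r" shows "\<exists>r. node_result x \<sigma> r"
proof (induction \<sigma> rule: address_induct)
  case root
  then show ?case using assms by (auto simp: node_root pair_eta)
next
  case (child a \<sigma>)
  then obtain r where r: "node_result x \<sigma> r" by blast
  consider "node_name x \<sigma> 0 = 0" | "node_name x \<sigma> 0 = 1" | "node_name x \<sigma> 0 = 2"
    using dagger_rel_le_2[OF r] by metis
  then show ?case
  proof cases
    case 1
    then show ?thesis by (simp add: node_child dagger_rel_0)
  next
    case 2
    then show ?thesis using r unfolding dagger_rel_1[of "node_name x \<sigma>", OF 2] by (simp add: node_child) blast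
  next
    case 3
    then show ?thesis using r unfolding dagger_rel_2[of "node_name x \<sigma>", OF 3] by (simp add: node_child) blast
  qed
qed

definition result :: "baire \<Rightarrow> nat \<Rightarrow> baire" where
  "result x \<sigma> = (SOME r. node_result x \<sigma> r)"

lemma node_result_iff:
  assumes "dagger_rel f x r0" shows "node_result x \<sigma> r \<longleftrightarrow> r = result x \<sigma>"
proof -
  have "node_result x \<sigma> (result x \<sigma>)"
    unfolding result_def using node_result_ex[OF assms] by (rule someI_ex)
  moreover have "r = t" if "node_result x \<sigma> r" "node_result x \<sigma> t" for r t
    using dagger_rel_unique[of f, OF _ that] single_valued by blast
  ultimately show ?thesis by metis
qed

definition argument :: "baire \<Rightarrow> nat \<Rightarrow> baire" where
  "argument x \<sigma> = (\<lambda>k. run_table (result x (Suc (enc 0 \<sigma>))) (node_prog x \<sigma> 0) k - Suc 0)"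

definition witness :: "baire \<Rightarrow> nat \<Rightarrow> baire" where
  "witness x \<sigma> = (if node_name x \<sigma> 0 = 1
     then SOME \<mu>. \<forall>a b. Q a b (result x \<sigma> (2 * a)) (\<mu> a) (argument x \<sigma> (c a b)) else (\<lambda>_. 0))"

lemma result_1:
  assumes "dagger_rel f x r0" "node_name x \<sigma> 0 = 1"
  shows "result x \<sigma> (Suc (2 * k)) = result x (Suc (enc 0 \<sigma>)) k"
    and "run_table (result x (Suc (enc 0 \<sigma>))) (node_prog x \<sigma> 0) k \<noteq> 0"
    and "Q a b (result x \<sigma> (2 * a)) (witness x \<sigma> a) (argument x \<sigma> (c a b))"
proof -
  have "node_result x \<sigma> (result x \<sigma>)" using node_result_iff[OF assms(1)] by blast
  then obtain h z s where h: "node_result x (Suc (enc 0 \<sigma>)) h"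
    and z: "Phi (node_prog x \<sigma> 0) h = Some z" and s: "s \<in> f z" "result x \<sigma> = pair s h"
    unfolding dagger_rel_1[of "node_name x \<sigma>", OF assms(2)] by (auto simp: node_child assms(2))
  have h': "h = result x (Suc (enc 0 \<sigma>))" using h node_result_iff[OF assms(1)] by blast
  then show "result x \<sigma> (Suc (2 * k)) = result x (Suc (enc 0 \<sigma>)) k"
    and "run_table (result x (Suc (enc 0 \<sigma>))) (node_prog x \<sigma> 0) k \<noteq> 0"
    using z s by (simp_all add: Phi_run_table)
  have "argument x \<sigma> = z" using z by (auto simp: argument_def h' Phi_run_table)
  moreover have "s = (\<lambda>a. result x \<sigma> (2 * a))" using s(2) by (auto simp: fun_eq_iff)
  ultimately have "\<exists>\<mu>. \<forall>a b. Q a b (result x \<sigma> (2 * a)) (\<mu> a) (argument x \<sigma> (c a b))"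
    using s(1) graph by auto
  from someI_ex[OF this] show "Q a b (result x \<sigma> (2 * a)) (witness x \<sigma> a) (argument x \<sigma> (c a b))"
    using assms(2) by (simp add: witness_def)
qed

definition eval_record :: "baire \<Rightarrow> baire" where
  "eval_record x v = (let t = lft v; \<sigma> = lft (rgt v); k = rgt (rgt v) in
     if t = 0 then node_name x \<sigma> k else if t = 1 then node_prog x \<sigma> k
     else if t = 2 then result x \<sigma> k else if t = 3 then run_table (result x \<sigma>) (lft k) (rgt k)
     else if t = 4 then search_table (result x \<sigma>) (lft k) (lft (rgt k)) (rgt (rgt k))
     else if t = 5 then witness x \<sigma> k else 0)"

lemma cell_record:
  "cell (eval_record x) 0 = node_name x" "cell (eval_record x) 1 = node_prog x" "cell (eval_record x) 2 = result x"
  "cell (eval_record x) 3 \<sigma> k = run_table (result x \<sigma>) (lft k) (rgt k)"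
  "cell (eval_record x) 4 \<sigma> k = search_table (result x \<sigma>) (lft k) (lft (rgt k)) (rgt (rgt k))"
  "cell (eval_record x) 5 = witness x" "cell (eval_record x) (6 + a) \<sigma> k = 0"
  by (auto simp: cell_def eval_record_def Let_def fun_eq_iff)

lemma record_cond_record:
  assumes "dagger_rel f x r0" shows "record_cond x v (eval_record x)"
proof -
  note iff = node_result_iff[OF assms]
  have "node_cond x (eval_record x) \<sigma> a k" for \<sigma> a k
    unfolding node_cond_def cell_record by (simp add: node_root node_child)
  moreover have "result_cond (eval_record x) \<sigma> a b k" for \<sigma> a b k
  proof -
    have r: "node_result x \<sigma> (result x \<sigma>)" using iff by blast
    have "result x \<sigma> (enc a k) = result x (Suc (enc a \<sigma>)) k" if "node_name x \<sigma> 0 = 2"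
    proof -
      have "node_result x (Suc (enc a \<sigma>)) (\<lambda>k. result x \<sigma> (enc a k))"
        using r that by (simp add: dagger_rel_2 node_child)
      then have "(\<lambda>k. result x \<sigma> (enc a k)) = result x (Suc (enc a \<sigma>))" using iff by blast
      then show ?thesis by metis
    qed
    moreover have "result x \<sigma> = node_prog x \<sigma>" if "node_name x \<sigma> 0 \<noteq> 1" "node_name x \<sigma> 0 \<noteq> 2"
      using r that dagger_rel_le_2[OF r] by (auto simp: dagger_rel_0)
    ultimately show ?thesis
      using result_1[OF assms, of \<sigma>]
      unfolding result_cond_def cell_record by (simp add: argument_def witness_def)
  qed
  moreover have "table_cond_at (eval_record x) \<sigma> a b k n" for \<sigma> a b k n
    using table_cond_run_table by (simp add: table_cond_at_def cell_record)
  ultimately have "\<forall>v. record_cond x v (eval_record x)" unfolding record_cond_all by blast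
  then show ?thesis ..
qed

text \<open>Inputs are determined from the root towards the leaves, results in the opposite
  direction; each run and search table is determined by the result at its node, and each witness by
  \<open>unique_witness\<close>.\<close>

lemma record_unique:
  assumes "dagger_rel f x r0" and "\<forall>v. record_cond x v y" shows "y = eval_record x"
proof -
  note iff = node_result_iff[OF assms(1)]
  have node: "\<And>\<sigma> a k. node_cond x y \<sigma> a k" and res: "\<And>\<sigma> a b k. result_cond y \<sigma> a b k"
    and tab: "\<And>\<sigma> a b k n. table_cond_at y \<sigma> a b k n"
    using assms(2) unfolding record_cond_all by blast+
  have name: "cell y 0 \<sigma> = node_name x \<sigma>" and prog: "cell y 1 \<sigma> = node_prog x \<sigma>" for \<sigma>
  proof (induction \<sigma> rule: address_induct)
    case root
    { case 1 show ?case using node[unfolded node_cond_def] by (auto simp: node_root)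
    next
      case 2 show ?case using node[unfolded node_cond_def] by (auto simp: node_root) }
  next
    case (child a \<sigma>)
    { case 1 show ?case using node[unfolded node_cond_def] child by (auto simp: node_child)
    next
      case 2 show ?case using node[unfolded node_cond_def] child by (auto simp: node_child) }
  qed
  have "(\<lambda>n k. cell y 3 \<sigma> (enc n k)) = run_table (cell y 2 \<sigma>)"
    "(\<lambda>n k m. cell y 4 \<sigma> (enc n (enc k m))) = search_table (cell y 2 \<sigma>)" for \<sigma>
    by (rule table_cond_unique; rule tab[of \<sigma>, unfolded table_cond_at_def])+
  from this[THEN fun_cong, THEN fun_cong] this(2)[THEN fun_cong, THEN fun_cong, THEN fun_cong]
  have tables: "cell y 3 \<sigma> (enc n k) = run_table (cell y 2 \<sigma>) n k"
    "cell y 4 \<sigma> (enc n (enc k m)) = search_table (cell y 2 \<sigma>) n k m" for \<sigma> n k m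
    by blast+
  have run: "cell y 3 \<sigma> k = run_table (cell y 2 \<sigma>) (lft k) (rgt k)"
    and search: "cell y 4 \<sigma> k = search_table (cell y 2 \<sigma>) (lft k) (lft (rgt k)) (rgt (rgt k))" for \<sigma> k
    using tables(1)[of \<sigma> "lft k" "rgt k"] tables(2)[of \<sigma> "lft k" "lft (rgt k)" "rgt (rgt k)"] by simp_all
  \<comment> \<open>Here well-foundedness enters, as induction on the derivation. The address stays
    arbitrary, so the hypothesis applies to every node carrying the given input.\<close>
  have result: "cell y 2 \<sigma> = r" if "dagger_rel f w r" "w = pair (node_name x \<sigma>) (node_prog x \<sigma>)" for w r \<sigma>
    using that
  proof (induction arbitrary: \<sigma> rule: dagger_rel.induct)
    case (zero p q)
    then have "node_name x \<sigma> = 0 ## p" "node_prog x \<sigma> = q" by auto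
    then show ?case using res[of \<sigma>] by (auto simp: result_cond_def name prog[unfolded One_nat_def])
  next
    case (succ p q h n z s)
    then have p: "node_name x \<sigma> = 1 ## p" and q: "node_prog x \<sigma> = n ## q" by auto
    then have h: "cell y 2 (Suc (enc 0 \<sigma>)) = h"
      by (intro succ.IH) (simp add: node_child)
    have T: "cell y 3 (Suc (enc 0 \<sigma>)) (enc n k) = Suc (z k)" for k
      using succ.hyps by (simp add: run h Phi_run_table)
    have R: "cell y 2 \<sigma> (Suc (2 * k)) = h k"
      "Q a b (cell y 2 \<sigma> (2 * a)) (cell y 5 \<sigma> a) (z (c a b))" for a b k
      using res[of \<sigma> a b k] by (simp_all add: result_cond_def name prog[unfolded One_nat_def] p q h T)
    have "(\<lambda>a. cell y 2 \<sigma> (2 * a)) \<in> f z"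
      using R(2) by (intro graph[THEN iffD2] exI allI)
    then have "s = (\<lambda>a. cell y 2 \<sigma> (2 * a))" using single_valued succ.hyps by blast
    then show ?case using R(1) pair_eta[of "cell y 2 \<sigma>"] by simp
  next
    case (sup p q r)
    then have p: "node_name x \<sigma> = 2 ## tuple p" and q: "node_prog x \<sigma> = tuple q" by auto
    have "cell y 2 (Suc (enc a \<sigma>)) = r a" for a
      by (intro sup.IH) (simp add: node_child p q)
    then have "cell y 2 \<sigma> (enc a k) = r a k" for a k
      using res[of \<sigma> a 0 k] by (simp add: result_cond_def name p)
    from this[of "lft v" "rgt v" for v] show ?case by (simp add: fun_eq_iff tuple_apply)
  qed
  have result: "cell y 2 \<sigma> = result x \<sigma>" for \<sigma>
    using result iff by blast
  have witness: "cell y 5 \<sigma> = witness x \<sigma>" for \<sigma>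
  proof (cases "node_name x \<sigma> 0 = 1")
    case True
    have "\<forall>a b. Q a b (result x \<sigma> (2 * a)) (cell y 5 \<sigma> a) (argument x \<sigma> (c a b))"
      using res[of \<sigma>] True by (simp add: result_cond_def name prog[unfolded One_nat_def] run result argument_def)
    moreover have "\<forall>a b. Q a b (result x \<sigma> (2 * a)) (witness x \<sigma> a) (argument x \<sigma> (c a b))"
      using result_1(3)[OF assms(1) True] by blast
    ultimately show ?thesis
      using unique_witness[of "\<lambda>a. result x \<sigma> (2 * a)" "cell y 5 \<sigma>" "argument x \<sigma>"
        "\<lambda>a. result x \<sigma> (2 * a)" "witness x \<sigma>"] by simp
  next
    case False
    then show ?thesis using res[of \<sigma>] by (auto simp: result_cond_def name witness_def)
  qed
  have "cell y t \<sigma> k = cell (eval_record x) t \<sigma> k" for t \<sigma> k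
  proof -
    consider "t = 0" | "t = 1" | "t = 2" | "t = 3" | "t = 4" | "t = 5" | a where "t = 6 + a"
    proof -
      have "t = 0 \<or> t = 1 \<or> t = 2 \<or> t = 3 \<or> t = 4 \<or> t = 5 \<or> (\<exists>a. t = 6 + a)" by presburger
      then show thesis using that by blast
    qed
    then show ?thesis
    proof cases
      case 7
      then show ?thesis using node[of \<sigma> a k] by (simp only: node_cond_def cell_record)
    qed (simp_all only: cell_record name prog run search result witness)
  qed
  then have "y (enc t (enc \<sigma> k)) = eval_record x (enc t (enc \<sigma> k))" for t \<sigma> k
    by (simp add: cell_def)
  from this[of "lft v" "lft (rgt v)" "rgt (rgt v)" for v] show ?thesis by (simp add: fun_eq_iff)
qed

lemma dagger_le_UC: "f\<^sup>\<dagger> \<le>\<^sub>W UC_Baire"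
proof (rule weihrauch_le_UC_I[OF recfun_prefix_record_cond])
  show "recfun (\<lambda>y k. cell y 2 0 k)" unfolding cell_def by (intro rec_intros)
  show "\<exists>y. {y. \<forall>v. record_cond x v y} = {y} \<and> (\<lambda>k. cell y 2 0 k) \<in> f\<^sup>\<dagger> x" if r: "r \<in> f\<^sup>\<dagger> x" for x r
  proof -
    have r: "dagger_rel f x r" using r by (simp add: dagger_def)
    have "node_result x 0 (result x 0)" using node_result_iff[OF r] by blast
    then have "cell (eval_record x) 2 0 \<in> f\<^sup>\<dagger> x"
      by (simp add: dagger_def cell_record node_root pair_eta)
    then show ?thesis
      using record_cond_record[OF r] record_unique[OF r]
      by (intro exI[of _ "eval_record x"] conjI equalityI subsetI) simp_all
  qed
qed

end

section \<open>Reducing unique choice to the iteration\<close>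

definition cyl :: "nat \<Rightarrow> baire set" where "cyl w = cylinder (list_decode w)"

text \<open>In reversed words, appending an entry is a single \<open>Suc (enc i c)\<close> on
  codes.\<close>

definition rev_prefix :: "baire \<Rightarrow> nat \<Rightarrow> nat" where
  "rev_prefix X n = list_encode (rev (map X [0..<n]))"

text \<open>\<open>w\<close> is read forwards and \<open>b\<close> backwards: the word stored in
  \<open>b\<close> extends \<open>w\<close>.\<close>

definition agrees :: "nat \<Rightarrow> nat \<Rightarrow> bool" where
  "agrees w b \<longleftrightarrow> code_len w \<le> code_len b \<and>
     (\<forall>j<code_len w. code_nth w j = code_nth b (code_len b - Suc j))"

lemma code_len_eq: "code_len c = length (list_decode c)"
  using code_len_list_encode[of "list_decode c"] by simp

lemma code_nth_eq: "j < code_len c \<Longrightarrow> code_nth c j = list_decode c ! j"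
  using code_nth_list_encode[of j "list_decode c"] by (simp add: code_len_eq)

lemma code_len_0: "code_len 0 = 0"
  by (simp add: code_len_def)

lemma code_len_Cons [simp]: "code_len (Suc (enc i c)) = Suc (code_len c)"
  by (simp add: code_len_eq)

lemma in_cyl: "X \<in> cyl w \<longleftrightarrow> (\<forall>j<code_len w. code_nth w j = X j)"
  by (auto simp: cyl_def cylinder_def code_len_eq code_nth_eq)

lemma rev_prefix_0 [simp]: "rev_prefix X 0 = 0"
  by (simp add: rev_prefix_def)

lemma rev_prefix_Suc [simp]: "rev_prefix X (Suc n) = Suc (enc (X n) (rev_prefix X n))"
  by (simp add: rev_prefix_def)

lemma code_len_rev_prefix [simp]: "code_len (rev_prefix X n) = n"
  by (simp add: rev_prefix_def)

lemma code_nth_rev_prefix [simp]: "j < n \<Longrightarrow> code_nth (rev_prefix X n) (n - Suc j) = X j"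
  by (simp add: rev_prefix_def rev_nth)

lemma agrees_rev_prefix: "agrees w (rev_prefix X n) \<longleftrightarrow> code_len w \<le> n \<and> X \<in> cyl w"
  by (auto simp: agrees_def in_cyl)

text \<open>
  Given a name \<open>p\<close> of a closed set and a word \<open>w\<close>, two players alternately extend a word of their
  own by one entry. The words of the first player must be compatible with \<open>w\<close>, those of the second
  player must not extend \<open>w\<close>. Whoever violates this, or is seen to leave the closed set, loses. An infinite play
  would yield two different points of the closed set; so if the set is a singleton, then the game is
  well-founded, and a player who follows the only point never loses.

  In a position coded by \<open>w\<close>, \<open>a\<close>, \<open>b\<close>, the player with the reversed word \<open>a\<close> is to move, and the
  reversed word \<open>b\<close> belongs to the one who has just moved; this is the second player iff
  both words have the same length.
\<close>

definition alive :: "baire \<Rightarrow> nat \<Rightarrow> bool" where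
  "alive p s \<longleftrightarrow> (\<forall>m<code_len (rgt (rgt s)). \<not> p m = 0 \<longrightarrow> \<not> agrees (p m - Suc 0) (rgt (rgt s))) \<and>
     (code_len (lft (rgt s)) = code_len (rgt (rgt s)) \<longrightarrow> \<not> agrees (lft s) (rgt (rgt s))) \<and>
     (\<not> code_len (lft (rgt s)) = code_len (rgt (rgt s)) \<longrightarrow>
       (\<forall>j<code_len (rgt (rgt s)). j < code_len (lft s) \<longrightarrow>
          code_nth (lft s) j = code_nth (rgt (rgt s)) (code_len (rgt (rgt s)) - Suc j)))"

definition move :: "nat \<Rightarrow> nat \<Rightarrow> nat" where
  "move s i = enc (lft s) (enc (rgt (rgt s)) (Suc (enc i (lft (rgt s)))))"

definition start :: "nat \<Rightarrow> nat" where "start w = enc w (enc 0 0)"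

lemma recfun_agrees [rec_intros]:
  assumes "recfun f" "recfun g" shows "recfun (\<lambda>p x. of_bool (agrees (f p x) (g p x)))"
  by (rule recfun_compose2[OF _ assms, where F="\<lambda>p a b. of_bool (agrees a b)"])
    (unfold agrees_def, intro rec_intros)

lemma recfun_alive [rec_intros]:
  assumes "recfun f" shows "recfun (\<lambda>p x. of_bool (alive p (f p x)))"
proof -
  have "recfun (\<lambda>p s. of_bool (alive p s))"
    unfolding alive_def by (intro rec_intros)
  from recfun_compose[OF this assms] show ?thesis .
qed

lemma recfun_move [rec_intros]:
  "recfun f \<Longrightarrow> recfun g \<Longrightarrow> recfun (\<lambda>p x. move (f p x) (g p x))"
  unfolding move_def by (intro rec_intros)

lemma move_enc [simp]: "move (enc w (enc a b)) i = enc w (enc b (Suc (enc i a)))"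
  by (simp add: move_def)

definition enum_set :: "baire \<Rightarrow> baire set" where
  "enum_set p = - (\<Union>w \<in> {w. \<exists>n. p n = Suc (list_encode w)}. cylinder w)"

lemma delta_closed_enum_set: "delta_closed p = Some (enum_set p)"
  by (simp add: delta_closed_def enum_set_def)

lemma in_enum_set: "X \<in> enum_set p \<longleftrightarrow> (\<forall>m. p m \<noteq> 0 \<longrightarrow> X \<notin> cyl (p m - Suc 0))"
proof
  assume X: "X \<in> enum_set p"
  have "X \<notin> cyl (p m - Suc 0)" if "p m \<noteq> 0" for m
  proof -
    have "p m = Suc (list_encode (list_decode (p m - Suc 0)))" using that by simp
    then show ?thesis using X unfolding enum_set_def cyl_def by blast
  qed
  then show "\<forall>m. p m \<noteq> 0 \<longrightarrow> X \<notin> cyl (p m - Suc 0)" by blast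
next
  assume *: "\<forall>m. p m \<noteq> 0 \<longrightarrow> X \<notin> cyl (p m - Suc 0)"
  have "X \<notin> cylinder w" if "p n = Suc (list_encode w)" for w n
    using *[rule_format, of n] that by (simp add: cyl_def)
  then show "X \<in> enum_set p" by (auto simp: enum_set_def)
qed

lemma alive_rev_prefix:
  "alive p (enc w (enc a (rev_prefix X n))) \<longleftrightarrow>
     (\<forall>m<n. p m \<noteq> 0 \<longrightarrow> \<not> (code_len (p m - Suc 0) \<le> n \<and> X \<in> cyl (p m - Suc 0))) \<and>
     (if code_len a = n then \<not> (code_len w \<le> n \<and> X \<in> cyl w)
      else \<forall>j<n. j < code_len w \<longrightarrow> code_nth w j = X j)"
  by (auto simp: alive_def agrees_rev_prefix)

text \<open>A position consults only as many entries of \<open>p\<close> as the word is long, which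
  keeps \<open>alive\<close> decidable. Arbitrarily long surviving prefixes therefore rule out every
  enumerated word.\<close>

lemma in_enum_setI:
  assumes "\<And>n. \<exists>k\<ge>n. \<exists>w a. alive p (enc w (enc a (rev_prefix X k)))" shows "X \<in> enum_set p"
  unfolding in_enum_set
proof (intro allI impI notI)
  fix m assume m: "p m \<noteq> 0" "X \<in> cyl (p m - Suc 0)"
  obtain k w a where "k \<ge> max (Suc m) (code_len (p m - Suc 0))" "alive p (enc w (enc a (rev_prefix X k)))"
    using assms by blast
  then show False using m unfolding alive_rev_prefix by auto
qed

text \<open>Well-foundedness of the game tree below a position; dead positions satisfy the premise
  vacuously and start the induction.\<close>

inductive terminates :: "baire \<Rightarrow> nat \<Rightarrow> bool" for p where
  "(\<And>i. alive p s \<Longrightarrow> terminates p (move s i)) \<Longrightarrow> terminates p s"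

lemma terminates_start:
  assumes "enum_set p = {x}" shows "terminates p (start w)"
proof (rule ccontr)
  assume not: "\<not> terminates p (start w)"
  define i where "i s = (SOME i. \<not> terminates p (move s i))" for s
  have i: "alive p s \<and> \<not> terminates p (move s (i s))" if "\<not> terminates p s" for s
  proof -
    have "alive p s \<and> (\<exists>i. \<not> terminates p (move s i))"
      using that terminates.intros by blast
    then show ?thesis unfolding i_def by (metis (mono_tags) someI_ex)
  qed
  define S where "S = rec_nat (start w) (\<lambda>_ s. move s (i s))"
  have S: "S 0 = start w" "S (Suc t) = move (S t) (i (S t))" for t
    by (simp_all add: S_def)
  have nt: "\<not> terminates p (S t)" for t
    by (induction t) (simp_all add: S not i)
  then have alive: "alive p (S t)" for t using i by blast
  define X where "X t = i (S (2 * t))" for t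
  define Y where "Y t = i (S (Suc (2 * t)))" for t
  \<comment> \<open>At even times the words have equal length and the first player, who builds
    \<open>X\<close>, is to move. At odd times the word of \<open>X\<close> is one entry
    longer.\<close>
  have even: "S (2 * t) = enc w (enc (rev_prefix X t) (rev_prefix Y t))" for t
    by (induction t) (simp_all add: S start_def X_def Y_def)
  have odd: "S (Suc (2 * t)) = enc w (enc (rev_prefix Y t) (rev_prefix X (Suc t)))" for t
    by (simp only: S even move_enc rev_prefix_Suc) (simp add: X_def even)
  have "Y \<in> enum_set p"
    by (rule in_enum_setI) (metis even alive order_refl)
  moreover have "X \<in> enum_set p"
    by (rule in_enum_setI) (metis odd alive le_SucI order_refl)
  \<comment> \<open>At these times the inspected word is at least as long as \<open>w\<close>, so
    the rule for its player decides membership in the cylinder.\<close>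
  moreover have "Y \<notin> cyl w"
    using alive[of "2 * code_len w"] unfolding even alive_rev_prefix by simp
  moreover have "X \<in> cyl w"
    using alive[of "Suc (2 * code_len w)"] unfolding odd alive_rev_prefix in_cyl by simp
  ultimately show False using assms by auto
qed

text \<open>A live position becomes \<open>1\<close> followed by \<open>2\<close>: one application
  of \<open>f\<close> on top of a supremum over all moves. Recursion on the entry index
  \<open>k\<close>, not on the game, makes the name total for every \<open>p\<close>.\<close>

function game_name :: "baire \<Rightarrow> nat \<Rightarrow> baire" where
  "game_name p s k = (if \<not> alive p s then 0 else if k = 0 then 1 else if k = 1 then 2
     else game_name p (move s (lft (k - 2))) (rgt (k - 2)))"
  by auto
termination
  by (relation "measure (\<lambda>(p, s, k). k)") (auto intro!: le_less_trans[OF rgt_le])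

text \<open>Only the application of \<open>f\<close> consumes an input entry, namely
  \<open>n\<close>, hence a shift by 1 where the name shifts by 2. A dead position returns the
  constant 1: the player who has just moved lost, so the one to move wins.\<close>

function game_prog :: "nat \<Rightarrow> baire \<Rightarrow> nat \<Rightarrow> baire" where
  "game_prog n p s k = (if \<not> alive p s then 1 else if k = 0 then n
     else game_prog n p (move s (lft (k - 1))) (rgt (k - 1)))"
  by auto
termination
  by (relation "measure (\<lambda>(n, p, s, k). k)") (auto intro!: le_less_trans[OF rgt_le])

declare game_name.simps [simp del] game_prog.simps [simp del]

lemma recfun_game_name [rec_intros]:
  assumes "recfun f" "recfun g" shows "recfun (\<lambda>p x. game_name p (f p x) (g p x))"
proof -
  have "recfun (\<lambda>p z. game_name p (lft z) (rgt z))"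
  proof (rule recfun_tail_recursion[where P="\<lambda>p z. \<not> (alive p (lft z) \<and> 2 \<le> rgt z)"
        and out="\<lambda>p z. if \<not> alive p (lft z) then 0 else if rgt z = 0 then 1 else 2"
        and step="\<lambda>p z. enc (move (lft z) (lft (rgt z - 2))) (rgt (rgt z - 2))"])
    fix p z
    show "game_name p (lft z) (rgt z) = (if \<not> (alive p (lft z) \<and> 2 \<le> rgt z)
       then if \<not> alive p (lft z) then 0 else if rgt z = 0 then 1 else 2
       else game_name p (lft (enc (move (lft z) (lft (rgt z - 2))) (rgt (rgt z - 2))))
         (rgt (enc (move (lft z) (lft (rgt z - 2))) (rgt (rgt z - 2)))))"
      by (subst game_name.simps) auto
  qed (auto intro!: rec_intros le_less_trans[OF rgt_le])
  from recfun_compose2[OF this assms] show ?thesis .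
qed

lemma recfun_game_prog [rec_intros]:
  assumes "recfun f" "recfun g" shows "recfun (\<lambda>p x. game_prog n p (f p x) (g p x))"
proof -
  have "recfun (\<lambda>p z. game_prog n p (lft z) (rgt z))"
  proof (rule recfun_tail_recursion[where P="\<lambda>p z. \<not> (alive p (lft z) \<and> 1 \<le> rgt z)"
        and out="\<lambda>p z. if \<not> alive p (lft z) then 1 else n"
        and step="\<lambda>p z. enc (move (lft z) (lft (rgt z - 1))) (rgt (rgt z - 1))"])
    fix p z
    show "game_prog n p (lft z) (rgt z) = (if \<not> (alive p (lft z) \<and> 1 \<le> rgt z)
       then if \<not> alive p (lft z) then 1 else n
       else game_prog n p (lft (enc (move (lft z) (lft (rgt z - 1))) (rgt (rgt z - 1))))
         (rgt (enc (move (lft z) (lft (rgt z - 1))) (rgt (rgt z - 1)))))"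
      by (subst game_prog.simps) auto
  qed (auto intro!: rec_intros le_less_trans[OF rgt_le])
  from recfun_compose2[OF this assms] show ?thesis .
qed

lemma game_name_dead: "\<not> alive p s \<Longrightarrow> game_name p s = 0 ## (\<lambda>_. 0)"
  by (auto simp: game_name.simps scons_def fun_eq_iff split: nat.split)

lemma game_prog_dead: "\<not> alive p s \<Longrightarrow> game_prog n p s = (\<lambda>_. 1)"
  by (auto simp: game_prog.simps)

lemma game_name_alive:
  assumes "alive p s" shows "game_name p s = 1 ## 2 ## tuple (\<lambda>i. game_name p (move s i))"
proof
  fix k
  show "game_name p s k = (1 ## 2 ## tuple (\<lambda>i. game_name p (move s i))) k"
    using assms by (subst game_name.simps) (simp add: scons_def tuple_apply split: nat.split)
qed

lemma game_prog_alive: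
  assumes "alive p s" shows "game_prog n p s = n ## tuple (\<lambda>i. game_prog n p (move s i))"
proof
  fix k
  show "game_prog n p s k = (n ## tuple (\<lambda>i. game_prog n p (move s i))) k"
    using assms by (subst game_prog.simps) (simp add: scons_def tuple_apply split: nat.split)
qed

text \<open>To find \<open>x k\<close>, search for a word of length \<open>Suc k\<close> whose
  cylinder contains \<open>x\<close> and take its last entry.\<close>

lemma search_program:
  "\<exists>c. \<forall>p r x k. (\<forall>w. r (enc w 0) = 0 \<longleftrightarrow> x \<notin> cyl w) \<longrightarrow> run c (pair p r) k = Some (x k)"
proof -
  \<comment> \<open>The oracle is \<open>pair p r\<close>, so the odd entry read here is
    \<open>r (enc w 0)\<close>. The test returns 0 on success because \<open>Mu\<close> looks for a
    zero.\<close>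
  have "recfun (\<lambda>p z. if code_len (rgt z) = Suc (lft z) then if p (Suc (2 * enc (rgt z) 0)) = 0 then 1 else 0 else 1)"
    by (intro rec_intros)
  then obtain b where b: "\<And>p z. run b p z =
      Some (if code_len (rgt z) = Suc (lft z) then if p (Suc (2 * enc (rgt z) 0)) = 0 then 1 else 0 else 1)"
    by (rule recfunE) (rule that)
  have "recfun (\<lambda>p z. code_nth (rgt z) (lft z))"
    by (intro rec_intros)
  then obtain e where e: "\<And>p z. run e p z = Some (code_nth (rgt z) (lft z))"
    by (rule recfunE) (rule that)
  have "run (Comp e (Pair (Pair Left Right) (Mu b))) (pair p r) k = Some (x k)"
    if r: "\<forall>w. r (enc w 0) = 0 \<longleftrightarrow> x \<notin> cyl w" for p r x k
  proof -
    define good where "good i \<longleftrightarrow> code_len i = Suc k \<and> x \<in> cyl i" for i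
    define i where "i = (LEAST i. good i)"
    have "good (list_encode (map x [0..<Suc k]))"
      unfolding good_def cyl_def cylinder_def code_len_list_encode list_encode_inverse
      by (auto simp del: upt_Suc)
    then have i: "good i" unfolding i_def by (rule LeastI)
    have b: "run b (pair p r) (enc k j) = Some (if good j then 0 else Suc 0)" for j
      by (simp add: b r good_def)
    have "\<not> good j" if "j < i" for j
      using that unfolding i_def by (rule not_less_Least)
    then have "run (Mu b) (pair p r) k = Some i"
      unfolding run_Mu_Some b using i by simp
    moreover have "run (Pair Left Right) (pair p r) k = Some k" by simp
    ultimately have "run (Pair (Pair Left Right) (Mu b)) (pair p r) k = Some (enc k i)"
      by (simp only: run.simps(6) bind.bind_lunit)
    then have "run (Comp e (Pair (Pair Left Right) (Mu b))) (pair p r) k = Some (code_nth i k)"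
      by (simp only: run.simps(7) bind.bind_lunit e lft_enc rgt_enc)
    then show ?thesis using i by (simp only: good_def in_cyl)
  qed
  then show ?thesis by blast
qed

text \<open>Program \<open>n\<close> asks \<open>f\<close> whether some component of a tuple starts
  with 0. The answer is the \<open>delta_nat\<close> name of 0 for yes and of 1 for no, so it starts
  with 1 iff such a component exists: a position is won iff some move leads to a lost one.\<close>

locale zero_test =
  fixes f :: "baire \<Rightarrow> baire set" and n :: nat
  assumes single_valued: "s \<in> f z \<Longrightarrow> t \<in> f z \<Longrightarrow> s = t"
    and test: "\<exists>z. Phi n h = Some z \<and> (\<lambda>k. of_bool (k = (if \<exists>j. h (enc j 0) = 0 then 0 else 1))) \<in> f z"
begin

text \<open>
  A result should start with \<open>0\<close> iff the player to move loses. This is only required at positions where a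
  player has followed \<open>x\<close> so far: the first one if \<open>x\<close> extends \<open>w\<close>, and the second one otherwise.
\<close>

definition valued :: "baire \<Rightarrow> nat \<Rightarrow> baire \<Rightarrow> bool" where
  "valued x s r \<longleftrightarrow>
    (\<forall>w b m. s = enc w (enc (rev_prefix x m) b) \<longrightarrow> code_len b = (if x \<in> cyl w then m else Suc m) \<longrightarrow>
       r 0 \<noteq> 0) \<and>
    (\<forall>w a m. s = enc w (enc a (rev_prefix x m)) \<longrightarrow>
       m = (if x \<in> cyl w then Suc (code_len a) else code_len a) \<longrightarrow> r 0 = 0)"

lemma valued_win: "valued x (enc w (enc (rev_prefix x m) b)) r \<Longrightarrow>
    code_len b = (if x \<in> cyl w then m else Suc m) \<Longrightarrow> r 0 \<noteq> 0"
  and valued_lose: "valued x (enc w (enc a (rev_prefix x m))) r \<Longrightarrow>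
    m = (if x \<in> cyl w then Suc (code_len a) else code_len a) \<Longrightarrow> r 0 = 0"
  unfolding valued_def by blast+

text \<open>Following \<open>x\<close> is a winning strategy for the player on whose side of the
  cylinder \<open>x\<close> lies; the induction carries this from the dead positions
  upwards.\<close>

lemma game_value:
  assumes "x \<in> enum_set p"
  shows "terminates p s \<Longrightarrow> \<exists>r. dagger_rel f (pair (game_name p s) (game_prog n p s)) r \<and> valued x s r"
proof (induction rule: terminates.induct)
  case (1 s)
  show ?case
  proof (cases "alive p s")
    case False
    \<comment> \<open>A player who has just followed \<open>x\<close> has broken no rule, so a dead
      position is never one that has to be valued 0.\<close>
    have "alive p (enc w (enc a (rev_prefix x m)))"
      if "m = (if x \<in> cyl w then Suc (code_len a) else code_len a)" for w a m
      using that assms by (auto simp: alive_rev_prefix in_enum_set in_cyl[of x w] split: if_splits)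
    then have "valued x s (\<lambda>_. 1)"
      using False unfolding valued_def by (metis zero_neq_one)
    moreover have "dagger_rel f (pair (game_name p s) (game_prog n p s)) (\<lambda>_. 1)"
      unfolding game_name_dead[OF False] game_prog_dead[OF False] by (rule dagger_rel.zero)
    ultimately show ?thesis by blast
  next
    case True
    have "\<forall>i. \<exists>r. dagger_rel f (pair (game_name p (move s i)) (game_prog n p (move s i))) r \<and>
        valued x (move s i) r"
      using 1[OF True] by blast
    from choice[OF this] obtain r
      where r: "\<And>i. dagger_rel f (pair (game_name p (move s i)) (game_prog n p (move s i))) (r i)"
        and v: "\<And>i. valued x (move s i) (r i)" by blast
    have win: "r i 0 \<noteq> 0" if "move s i = enc w (enc (rev_prefix x m) b)"
         "code_len b = (if x \<in> cyl w then m else Suc m)" for i w b m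
      using v that unfolding valued_def by blast
    have lose: "r i 0 = 0" if "move s i = enc w (enc a (rev_prefix x m))"
         "m = (if x \<in> cyl w then Suc (code_len a) else code_len a)" for i w a m
      using v that unfolding valued_def by blast
    define t :: baire where "t k = of_bool (k = (if \<exists>j. r j 0 = 0 then 0 else 1))" for k
    obtain z where z: "Phi n (tuple r) = Some z" "t \<in> f z"
      using test[of "tuple r"] unfolding t_def tuple_enc by blast
    have "dagger_rel f (pair (2 ## tuple (\<lambda>i. game_name p (move s i))) (tuple (\<lambda>i. game_prog n p (move s i)))) (tuple r)"
      by (rule dagger_rel.sup) (rule r)
    from dagger_rel.succ[OF this z]
    have "dagger_rel f (pair (game_name p s) (game_prog n p s)) (pair t (tuple r))"
      by (simp only: game_name_alive[OF True] game_prog_alive[OF True])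
    moreover have "pair t (tuple r) 0 \<noteq> 0"
      if s: "s = enc w (enc (rev_prefix x m) b)" and len: "code_len b = (if x \<in> cyl w then m else Suc m)" for w b m
    proof -
      \<comment> \<open>The winning move is the next entry of \<open>x\<close>.\<close>
      have "move s (x m) = enc w (enc b (rev_prefix x (Suc m)))" by (simp add: s)
      then have "r (x m) 0 = 0" by (rule lose) (use len in auto)
      then show ?thesis by (auto simp: t_def)
    qed
    moreover have "pair t (tuple r) 0 = 0"
      if s: "s = enc w (enc a (rev_prefix x m))" and len: "m = (if x \<in> cyl w then Suc (code_len a) else code_len a)" for w a m
    proof -
      have "r j 0 \<noteq> 0" for j
      proof -
        have "move s j = enc w (enc (rev_prefix x m) (Suc (enc j a)))" by (simp add: s)
        then show ?thesis by (rule win) (use len in auto)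
      qed
      then show ?thesis by (simp add: t_def)
    qed
    ultimately show ?thesis unfolding valued_def by blast
  qed
qed

text \<open>One supremum at the root collects the games for all \<open>w\<close>, so a single use of
  the iteration decides all cylinders.\<close>

definition game_input :: "baire \<Rightarrow> baire" where
  "game_input p = pair (2 ## tuple (\<lambda>w. game_name p (start w))) (tuple (\<lambda>w. game_prog n p (start w)))"

lemma recfun_game_input: "recfun game_input"
proof -
  have "recfun (\<lambda>p k. if even k then if k div 2 = 0 then 2
      else game_name p (start (lft (k div 2 - 1))) (rgt (k div 2 - 1))
    else game_prog n p (start (lft (k div 2))) (rgt (k div 2)))"
    unfolding start_def by (intro rec_intros)
  moreover have "game_input p k = (if even k then if k div 2 = 0 then 2
      else game_name p (start (lft (k div 2 - 1))) (rgt (k div 2 - 1))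
    else game_prog n p (start (lft (k div 2))) (rgt (k div 2)))" for p k
    by (simp add: game_input_def pair_def scons_def tuple_apply split: nat.split)
  ultimately show ?thesis by (simp only: recfun_def)
qed

lemma game_result:
  assumes "enum_set p = {x}"
  shows "f\<^sup>\<dagger> (game_input p) \<noteq> {}"
    and "r \<in> f\<^sup>\<dagger> (game_input p) \<Longrightarrow> r (enc w 0) = 0 \<longleftrightarrow> x \<notin> cyl w"
proof -
  have x: "x \<in> enum_set p" using assms by simp
  have "\<exists>r. dagger_rel f (pair (game_name p (start w)) (game_prog n p (start w))) r \<and> (r 0 = 0 \<longleftrightarrow> x \<notin> cyl w)" for w
  proof -
    obtain r where r: "dagger_rel f (pair (game_name p (start w)) (game_prog n p (start w))) r"
      and v: "valued x (start w) r"
      using game_value[OF x terminates_start[OF assms]] by blast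
    \<comment> \<open>Both words are empty at the start, so the follower of \<open>x\<close> is the
      player to move if \<open>x\<close> lies in the cylinder and the opponent otherwise.\<close>
    have "r 0 = 0 \<longleftrightarrow> x \<notin> cyl w"
    proof (cases "x \<in> cyl w")
      case True
      then show ?thesis
        using valued_win[of x w 0 0 r] v by (simp add: start_def code_len_0)
    next
      case False
      then show ?thesis
        using valued_lose[of x w 0 0 r] v by (simp add: start_def code_len_0)
    qed
    with r show ?thesis by (intro exI conjI)
  qed
  then have "\<forall>w. \<exists>r. dagger_rel f (pair (game_name p (start w)) (game_prog n p (start w))) r \<and> (r 0 = 0 \<longleftrightarrow> x \<notin> cyl w)"
    by blast
  from choice[OF this] obtain r
    where r: "\<And>w. dagger_rel f (pair (game_name p (start w)) (game_prog n p (start w))) (r w)"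
      and r0: "\<And>w. r w 0 = 0 \<longleftrightarrow> x \<notin> cyl w" by blast
  have *: "tuple r \<in> f\<^sup>\<dagger> (game_input p)"
    unfolding dagger_def game_input_def mem_Collect_eq by (rule dagger_rel.sup) (rule r)
  then show "f\<^sup>\<dagger> (game_input p) \<noteq> {}" by blast
  show "r' (enc w 0) = 0 \<longleftrightarrow> x \<notin> cyl w" if "r' \<in> f\<^sup>\<dagger> (game_input p)" for r'
  proof -
    have d: "dagger_rel f (game_input p) r'" "dagger_rel f (game_input p) (tuple r)"
      using that * by (simp_all add: dagger_def)
    have "r' = tuple r"
      using dagger_rel_unique[of f, OF _ d] single_valued by blast
    then show ?thesis using r0 by simp
  qed
qed

lemma UC_le_dagger: "UC_Baire \<le>\<^sub>W f\<^sup>\<dagger>"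
proof -
  obtain c where c: "run c (pair p r) k = Some (x k)"
    if "\<And>w. r (enc w 0) = 0 \<longleftrightarrow> x \<notin> cyl w" for p r x k
    using search_program by blast
  define K where "K = Phi (index c)"
  have "realizer (\<lambda>p. Option.bind (Some (game_input p)) (\<lambda>h. Option.bind (G h) (\<lambda>r. K (pair p r)))) UC_Baire"
    if G: "realizer G (f\<^sup>\<dagger>)" for G
    unfolding realizer_def
  proof (intro allI impI)
    fix p assume "UC_Baire p \<noteq> {}"
    then obtain x where x: "enum_set p = {x}"
      by (auto simp: UC_Baire_def on_names_def UC_map_def delta_closed_enum_set)
    then obtain r where r: "G (game_input p) = Some r" "r \<in> f\<^sup>\<dagger> (game_input p)"
      using G game_result(1) unfolding realizer_def by blast
    have "K (pair p r) = Some x"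
      unfolding K_def Phi_index_iff using c game_result(2)[OF x r(2)] by blast
    moreover have "UC_Baire p = {x}"
      using x by (simp add: UC_Baire_singleton delta_closed_enum_set)
    ultimately show "\<exists>q\<in>UC_Baire p. Option.bind (Some (game_input p)) (\<lambda>h. Option.bind (G h) (\<lambda>r. K (pair p r))) = Some q"
      using r by simp
  qed
  moreover have "computable K" unfolding K_def computable_def by (blast intro: map_le_refl)
  ultimately show ?thesis
    unfolding weihrauch_le_def using computable_recfun[OF recfun_game_input] by blast
qed

end

section \<open>The two basic problems\<close>

text \<open>The witness is 0 for the zero sequence and otherwise the successor of the position of
  the first 1, the same for every \<open>a\<close>. The last conjunct spells out the
  \<open>delta_nat\<close> name of the answer.\<close>

definition LPO_cond :: "nat \<Rightarrow> nat \<Rightarrow> nat \<Rightarrow> nat \<Rightarrow> nat \<Rightarrow> bool" where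
  "LPO_cond a b s \<mu> z \<longleftrightarrow> z \<le> 1 \<and> (\<mu> = 0 \<longrightarrow> z = 0) \<and> (Suc b < \<mu> \<longrightarrow> z = 0) \<and> (Suc b = \<mu> \<longrightarrow> z = 1) \<and>
     s = (if a = (if \<mu> = 0 then 1 else 0) then 1 else 0)"

text \<open>The witness is the modulus of convergence of column \<open>a\<close>; the second
  conjunct makes it least and thus unique.\<close>

definition Lim_cond :: "nat \<Rightarrow> nat \<Rightarrow> nat \<Rightarrow> nat \<Rightarrow> nat \<Rightarrow> bool" where
  "Lim_cond a b s \<mu> z \<longleftrightarrow> (\<mu> \<le> b \<longrightarrow> z = s) \<and> (Suc b = \<mu> \<longrightarrow> \<not> z = s)"

lemma delta_nat_eq: "delta_nat q = Some y \<longleftrightarrow> q = (\<lambda>k. of_bool (k = y))"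
proof -
  define e :: "nat \<Rightarrow> baire" where "e n = (\<lambda>k. of_bool (k = n))" for n
  have inj: "e m = e n \<Longrightarrow> m = n" for m n
    by (drule fun_cong[where x=m]) (simp add: e_def of_bool_def split: if_splits)
  have delta: "delta_nat q = (if \<exists>n. q = e n then Some (THE n. q = e n) else None)" for q
    by (simp only: delta_nat_def e_def)
  have "(THE n. e m = e n) = m" for m
    by (rule the_equality) (simp_all add: inj)
  then have e: "delta_nat (e m) = Some m" for m
    unfolding delta by auto
  have "delta_nat q = Some y \<longleftrightarrow> q = e y"
  proof (cases "\<exists>n. q = e n")
    case True
    then obtain n where "q = e n" by (elim exE)
    then show ?thesis by (auto simp: e dest: inj)
  next
    case False
    then have "q \<noteq> e y" by simp
    then show ?thesis using False by (simp add: delta)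
  qed
  then show ?thesis by (simp only: e_def)
qed

lemma LPO_eq:
  "LPO z = (if range z \<subseteq> {0, 1} then {\<lambda>k. of_bool (k = (if z = (\<lambda>_. 0) then 1 else 0))} else {})"
  by (auto simp: LPO_def on_names_def LPO_map_def delta_nat_eq)

lemma LPO_cond_iff:
  "(\<forall>a b. LPO_cond a b (s a) (\<mu> a) (z b)) \<longleftrightarrow> s \<in> LPO z \<and>
     \<mu> = (\<lambda>_. if z = (\<lambda>_. 0) then 0 else Suc (LEAST n. z n \<noteq> 0))" (is "?L \<longleftrightarrow> ?R")
proof
  assume L: ?L
  have "\<mu> a = (if z = (\<lambda>_. 0) then 0 else Suc (LEAST n. z n \<noteq> 0))" for a
  proof (cases "\<mu> a")
    case 0
    have "z b = 0" for b
    proof -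
      have "LPO_cond a b (s a) (\<mu> a) (z b)" using L by blast
      then show ?thesis using 0 by (simp add: LPO_cond_def)
    qed
    then show ?thesis using 0 by (simp add: fun_eq_iff)
  next
    case (Suc m)
    have "LPO_cond a b (s a) (\<mu> a) (z b)" for b using L by blast
    then have "z m = 1" and less: "b < m \<Longrightarrow> z b = 0" for b
      using Suc by (simp_all add: LPO_cond_def)
    then have "(LEAST n. z n \<noteq> 0) = m"
      by (intro Least_equality) (auto simp: not_less[symmetric])
    moreover have "z \<noteq> (\<lambda>_. 0)" using \<open>z m = 1\<close> by auto
    ultimately show ?thesis using Suc by simp
  qed
  then have \<mu>: "\<mu> = (\<lambda>_. if z = (\<lambda>_. 0) then 0 else Suc (LEAST n. z n \<noteq> 0))" by (rule ext)
  have "z b \<le> 1" for b using L by (simp add: LPO_cond_def)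
  then have "z b \<in> {0, 1}" for b by (simp add: le_Suc_eq)
  then have "range z \<subseteq> {0, 1}" by (rule image_subsetI)
  moreover have "s a = of_bool (a = (if z = (\<lambda>_. 0) then 1 else 0))" for a
  proof -
    have "\<mu> a = 0 \<longleftrightarrow> z = (\<lambda>_. 0)" by (simp add: \<mu>)
    moreover have "LPO_cond a 0 (s a) (\<mu> a) (z 0)" using L by blast
    ultimately show ?thesis unfolding LPO_cond_def of_bool_def by presburger
  qed
  then have "s = (\<lambda>a. of_bool (a = (if z = (\<lambda>_. 0) then 1 else 0)))" by (rule ext)
  ultimately have "s \<in> LPO z" by (simp only: LPO_eq if_True singleton_iff)
  then show ?R using \<mu> by (rule conjI)
next
  assume R: ?R
  have z: "range z \<subseteq> {0, 1}"
  proof (rule ccontr)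
    assume "\<not> range z \<subseteq> {0, 1}"
    then have "LPO z = {}" by (simp only: LPO_eq if_False)
    then show False using R by simp
  qed
  then have s: "s = (\<lambda>k. of_bool (k = (if z = (\<lambda>_. 0) then 1 else 0)))"
    and \<mu>: "\<mu> = (\<lambda>_. if z = (\<lambda>_. 0) then 0 else Suc (LEAST n. z n \<noteq> 0))"
    using R by (simp_all only: LPO_eq if_True singleton_iff)
  have z01: "z b = 0 \<or> z b = 1" for b using z unfolding image_subset_iff by simp
  have "LPO_cond a b (s a) (\<mu> a) (z b)" for a b
  proof (cases "z = (\<lambda>_. 0)")
    case True
    then have "\<mu> a = 0" "s a = of_bool (a = 1)" by (simp_all add: s \<mu>)
    then show ?thesis using True by (simp add: LPO_cond_def)
  next
    case False
    define m where "m = (LEAST n. z n \<noteq> 0)"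
    have "\<mu> a = Suc m" "s a = of_bool (a = 0)" using False by (simp_all add: s \<mu> m_def)
    moreover have "\<exists>n. z n \<noteq> 0" using False by auto
    then have "z m \<noteq> 0" unfolding m_def by (rule LeastI_ex)
    then have "z m = 1" using z01[of m] by simp
    moreover have "z b = 0" if "b < m"
      using not_less_Least[OF that[unfolded m_def]] by simp
    moreover have "z b \<le> 1" using z01[of b] by auto
    ultimately show ?thesis by (auto simp: LPO_cond_def)
  qed
  then show ?L by blast
qed

lemma Lim_Baire_eventually:
  "s \<in> Lim_Baire z \<longleftrightarrow> (\<forall>a. \<exists>N. \<forall>b\<ge>N. z (enc a b) = s a)"
  by (simp add: Lim_Baire_def tendsto_discrete eventually_sequentially)

lemma Lim_cond_iff:
  "(\<forall>a b. Lim_cond a b (s a) (\<mu> a) (z (enc a b))) \<longleftrightarrow> s \<in> Lim_Baire z \<and>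
     \<mu> = (\<lambda>a. LEAST N. \<forall>b\<ge>N. z (enc a b) = s a)" (is "?L \<longleftrightarrow> ?R")
proof
  assume L: ?L
  have "(LEAST N. \<forall>b\<ge>N. z (enc a b) = s a) = \<mu> a" for a
  proof (rule Least_equality)
    show "\<forall>b\<ge>\<mu> a. z (enc a b) = s a" using L by (simp add: Lim_cond_def)
    fix N assume N: "\<forall>b\<ge>N. z (enc a b) = s a"
    show "\<mu> a \<le> N"
    proof (rule ccontr)
      assume "\<not> \<mu> a \<le> N"
      then obtain b where "\<mu> a = Suc b" "N \<le> b" by (cases "\<mu> a") auto
      moreover have "Suc b = \<mu> a \<longrightarrow> z (enc a b) \<noteq> s a" using L by (simp add: Lim_cond_def)
      ultimately show False using N by simp
    qed
  qed
  moreover have "\<forall>b\<ge>\<mu> a. z (enc a b) = s a" for a using L by (simp add: Lim_cond_def)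
  ultimately show ?R by (auto simp: Lim_Baire_eventually)
next
  assume R: ?R
  have "Lim_cond a b (s a) (\<mu> a) (z (enc a b))" for a b
  proof -
    have \<mu>: "\<mu> a = (LEAST N. \<forall>b\<ge>N. z (enc a b) = s a)" using R by simp
    have ex: "\<exists>N. \<forall>b\<ge>N. z (enc a b) = s a" using R by (simp add: Lim_Baire_eventually)
    have tail: "\<forall>b\<ge>\<mu> a. z (enc a b) = s a" unfolding \<mu> using ex by (rule LeastI_ex)
    have "z (enc a b) \<noteq> s a" if b: "Suc b = \<mu> a"
    proof
      assume "z (enc a b) = s a"
      then have "\<forall>c\<ge>b. z (enc a c) = s a" using tail b by (metis Suc_leI le_eq_less_or_eq)
      then have "\<mu> a \<le> b" unfolding \<mu> by (rule Least_le)
      then show False using b by simp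
    qed
    then show ?thesis using tail by (simp add: Lim_cond_def)
  qed
  then show ?L by blast
qed

interpretation LPO: pi01_graph LPO LPO_cond "\<lambda>a b. b"
proof
  show "s \<in> LPO z \<longleftrightarrow> (\<exists>\<mu>. \<forall>a b. LPO_cond a b (s a) (\<mu> a) (z b))" for s z
    unfolding LPO_cond_iff by simp
  show "s = t \<and> \<mu> = \<nu>" if "\<forall>a b. LPO_cond a b (s a) (\<mu> a) (z b)" "\<forall>a b. LPO_cond a b (t a) (\<nu> a) (z b)"
    for s t \<mu> \<nu> z
    using that unfolding LPO_cond_iff by (simp add: LPO_eq split: if_splits)
  show "recfun (\<lambda>x v. rgt v)" by (intro rec_intros)
qed (unfold LPO_cond_def, intro rec_intros)

interpretation Lim: pi01_graph Lim_Baire Lim_cond "\<lambda>a b. enc a b"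
proof
  show "s \<in> Lim_Baire z \<longleftrightarrow> (\<exists>\<mu>. \<forall>a b. Lim_cond a b (s a) (\<mu> a) (z (enc a b)))" for s z
    unfolding Lim_cond_iff by simp
  show "s = t \<and> \<mu> = \<nu>" if "\<forall>a b. Lim_cond a b (s a) (\<mu> a) (z (enc a b))"
    "\<forall>a b. Lim_cond a b (t a) (\<nu> a) (z (enc a b))" for s t \<mu> \<nu> z
  proof -
    have "s a = t a" for a
      using that unfolding Lim_cond_iff Lim_Baire_def by (auto intro: LIMSEQ_unique)
    then have "s = t" by (rule ext)
    then show ?thesis using that unfolding Lim_cond_iff by simp
  qed
  show "recfun (\<lambda>x v. enc (lft v) (rgt v))" by (intro rec_intros)
qed (unfold Lim_cond_def, intro rec_intros)

text \<open>The instance marks with 1 the components starting with 0, and \<open>LPO\<close> answers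
  0 iff there is a mark.\<close>

lemma zero_test_LPO: "\<exists>n. zero_test LPO n"
proof -
  have "recfun (\<lambda>h j. if h (enc j 0) = 0 then 1 else 0)"
    by (intro rec_intros)
  then obtain n where n: "\<And>h. Phi n h = Some (\<lambda>j. if h (enc j 0) = 0 then 1 else 0)"
    by (rule recfun_index) (rule that)
  have "(\<lambda>k. of_bool (k = (if \<exists>j. h (enc j 0) = 0 then 0 else 1))) \<in> LPO (\<lambda>j. if h (enc j 0) = 0 then 1 else 0)"
    for h :: baire
  proof -
    let ?z = "\<lambda>j. if h (enc j 0) = 0 then 1 else 0 :: nat"
    have "?z = (\<lambda>_. 0) \<longleftrightarrow> \<not> (\<exists>j. h (enc j 0) = 0)" by (auto simp: fun_eq_iff)
    moreover have "range ?z \<subseteq> {0, 1}" by auto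
    ultimately show ?thesis
      unfolding LPO_eq by (cases "\<exists>j. h (enc j 0) = 0") (simp_all only: if_True if_False not_True_eq_False not_False_eq_True singleton_iff)
  qed
  then show ?thesis
    using n LPO.single_valued by (intro exI[of _ n] zero_test.intro) blast+
qed

text \<open>Stage \<open>b\<close> gives the answer based on the components below \<open>b\<close>.
  It changes at most once, when a zero appears, so the limit is the correct name.\<close>

lemma zero_test_Lim: "\<exists>n. zero_test Lim_Baire n"
proof -
  define g :: "baire \<Rightarrow> baire" where "g h k = (if lft k = (if \<exists>j<rgt k. h (enc j 0) = 0 then 0 else 1) then 1 else 0)" for h k
  have "recfun g"
    unfolding g_def by (intro rec_intros)
  then obtain n where n: "\<And>h. Phi n h = Some (g h)"
    by (rule recfun_index) (rule that)
  have "(\<lambda>k. of_bool (k = (if \<exists>j. h (enc j 0) = 0 then 0 else 1))) \<in> Lim_Baire (g h)" for h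
    unfolding Lim_Baire_eventually
  proof
    fix a
    show "\<exists>N. \<forall>b\<ge>N. g h (enc a b) = of_bool (a = (if \<exists>j. h (enc j 0) = 0 then 0 else 1))"
    proof (cases "\<exists>j. h (enc j 0) = 0")
      case True
      then obtain j where j: "h (enc j 0) = 0" by blast
      have "g h (enc a b) = of_bool (a = (if \<exists>j. h (enc j 0) = 0 then 0 else 1))" if "Suc j \<le> b" for b
      proof -
        have "\<exists>j<b. h (enc j 0) = 0" using j that by (intro exI[of _ j]) simp
        with True show ?thesis by (simp only: g_def lft_enc rgt_enc if_True of_bool_def)
      qed
      then show ?thesis by blast
    next
      case False
      have "g h (enc a b) = of_bool (a = (if \<exists>j. h (enc j 0) = 0 then 0 else 1))" for b
      proof -
        have "\<not> (\<exists>j<b. h (enc j 0) = 0)" using False by blast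
        with False show ?thesis by (simp only: g_def lft_enc rgt_enc if_False of_bool_def)
      qed
      then show ?thesis by blast
    qed
  qed
  then show ?thesis
    using n Lim.single_valued by (intro exI[of _ n] zero_test.intro) blast+
qed

theorem theorem72:
  shows "LPO\<^sup>\<dagger> \<equiv>\<^sub>W Lim_Baire\<^sup>\<dagger> \<and> Lim_Baire\<^sup>\<dagger> \<equiv>\<^sub>W UC_Baire"
proof -
  have "UC_Baire \<le>\<^sub>W LPO\<^sup>\<dagger>" "UC_Baire \<le>\<^sub>W Lim_Baire\<^sup>\<dagger>"
    using zero_test_LPO zero_test_Lim zero_test.UC_le_dagger by blast+
  then show ?thesis
    unfolding weihrauch_eq_def
    using LPO.dagger_le_UC Lim.dagger_le_UC weihrauch_le_trans by blast
qed

end
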